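(* Let $\mathcal S=\{\phi_e\}_{e\in E}$ be a finitely irreducible conformal GDMS (graph directed Markov system) in $\mathbb R^n$ such that $$X\setminus \overline{\bigcup_{e\in E}\phi_e(X_{t(e)})}\neq\emptyset .$$ Then the following hold. (i) The limit set $J_{\mathcal S}$ is porous at every fixed point of $\mathcal S$; in particular $J_{\mathcal S}$ is porous at a dense set of points of $J_{\mathcal S}$. (ii) For every $\varepsilon>0$ there exists a finite set $F=F(\varepsilon)\subset E$ with $\dim_{\mathcal H}(J_{\mathcal S_F})>\dim_{\mathcal H}(J_{\mathcal S})-\varepsilon$ such that $J_{\mathcal S}$ is porous at every $x\in J_{\mathcal S_F}$ with porosity constant depending only on $F$ and $\mathcal S$ (that is, there is $c\in(0,1)$ depending only on $F$ and $\mathcal S$ such that $J_{\mathcal S}$ is $c$-porous at every $x\in J_{\mathcal S_F}$). (iii) There exists a set $\tilde J\subset J_{\mathcal S}$ such that $\dim_{\mathcal H}(\tilde J)=\dim_{\mathcal H}(J_{\mathcal S})$ and $J_{\mathcal S}$ is porous at every $x\in\tilde J$.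
   Context: A GDMS $\mathcal S=\{V,E,A,t,i,\{X_v\}_{v\in V},\{\phi_e\}_{e\in E}\}$, abbreviated $\{\phi_e\}_{e\in E}$, consists of: a directed multigraph with a countable (finite or infinite) set of edges $E$ (the alphabet, having at least two elements) and a finite set of vertices $V$; an incidence matrix $A:E\times E\to\{0,1\}$; maps $i,t:E\to V$ with $t(a)=i(b)$ whenever $A_{ab}=1$; non-empty compact metric spaces $X_v$; injective contractions $\phi_e:X_{t(e)}\to X_{i(e)}$, all with Lipschitz constant at most a common $s\in(0,1)$. For every $v\in V$ there are $e,e'\in E$ with $t(e)=v$, $i(e')=v$. $E_A^n$ is the set of words $\omega=\omega_1\ldots\omega_n$ with $A_{\omega_k\omega_{k+1}}=1$ for all $k<n$; $E_A^*=\bigcup_{n\ge0}E_A^n$; $E_A^{\mathbb N}$ is the set of infinite admissible words; $\omega|_n=\omega_1\ldots\omega_n$. For $\omega\in E_A^n$, $n\ge1$, $\phi_\omega=\phi_{\omega_1}\circ\cdots\circ\phi_{\omega_n}:X_{t(\omega)}\to X_{i(\omega)}$ with $t(\omega)=t(\omega_n)$, $i(\omega)=i(\omega_1)$. $\mathcal S$ is finitely irreducible if there is a finite $\Lambda\subset E_A^*$ such that for all $a,b\in E$ there is $\omega\in\Lambda$ with $a\omega b\in E_A^*$. $X=\bigcup_{v}X_v$ (disjoint union), $\pi(\omega)$ is the unique point of $\bigcap_n\phi_{\omega|_n}(X_{t(\omega_n)})$ for $\omega\in E_A^{\mathbb N}$, and $J_{\mathcal S}=\pi(E_A^{\mathbb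 N})$ is the limit set. The GDMS is conformal if (1) each $X_v$ is a compact connected subset of a fixed $\mathbb R^n$ with $X_v=\overline{\operatorname{Int}X_v}$; (2) (open set condition) $\phi_a(\operatorname{Int}X_{t(a)})\cap\phi_b(\operatorname{Int}X_{t(b)})=\emptyset$ for $a\ne b$ in $E$; (3) for each $v$ there is an open connected $W_v\supset X_v$ such that each $\phi_e$ with $t(e)=v$ extends to a $C^1$ conformal diffeomorphism of $W_v$ into $W_{i(e)}$ (conformal: the derivative at each point is a similarity). Standing assumptions: compact sets $S_v$ with $X_v\subset\operatorname{Int}S_v\subset S_v\subset W_v$ are fixed, pairwise disjoint; and bounded distortion holds: there are $\alpha>0$, $K\ge1$ with $\big|\|D\phi_\omega(p)\|/\|D\phi_\omega(q)\|-1\big|\le K|p-q|^\alpha$ and $K^{-1}\le\|D\phi_\omega(p)\|/\|D\phi_\omega(q)\|\le K$ for all $\omega\in E_A^*$, $p,q\in S_{t(\omega)}$. A fixed point of $\mathcal S$ is a point $x_\omega$ with $\{x_\omega\}=\bigcap_{n\ge1}\phi_{\omega^n}(X_{t(\omega)})$, where $\omega\in E_A^*$ is a nonempty word with $\omega\omega\in E_A^*$ and $\omega^n$ is the $n$-fold concatenation. For $F\subset E$, $\mathcal S_F=\{\phi_e\}_{e\in F}$ and $J_{\mathcal S_F}=\pi(E_A^{\mathbb N}\cap F^{\mathbb N})$. $\dim_{\mathcal H}$ is Hausdorff dimension. Porosity (in $\mathbb R^n$): for a bounded $G\subset\mathbb R^n$, $x\in\mathbb R^n$, $r>0$, $\operatorname{por}(G,x,r)=\sup\{c\ge0: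 B(y,cr)\subset B(x,r)\setminus G\text{ for some }y\in\mathbb R^n\}$. $G$ is $c$-porous at $x$ ($c\in(0,1)$) if there is $r_0>0$ with $\operatorname{por}(G,x,r)\ge c$ for all $r\in(0,r_0)$; porous at $x$ if it is $c$-porous at $x$ for some $c\in(0,1)$. *)

theory Defs
  imports "HOL-Analysis.Analysis"
begin

section \<open>Hausdorff dimension\<close>

text \<open>
  The \<open>s\<close>-th power of the diameter, with the usual conventions that the empty set
  contributes \<open>0\<close> and a nonempty set contributes \<open>1\<close> for \<open>s = 0\<close>
  (in HOL, \<open>0 powr 0 = 0\<close>).
\<close>

definition diam_pow :: "real \<Rightarrow> 'a::metric_space set \<Rightarrow> ennreal" where
  "diam_pow s U =
     (if U = {} then 0 else if s = 0 then 1 else ennreal (diameter U powr s))"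

definition hausdorff_premeasure :: "real \<Rightarrow> real \<Rightarrow> 'a::metric_space set \<Rightarrow> ennreal" where
  "hausdorff_premeasure s \<delta> G =
     Inf {(\<Sum>k. diam_pow s (U k)) | U :: nat \<Rightarrow> 'a set.
            G \<subseteq> (\<Union>k. U k) \<and> (\<forall>k. bounded (U k) \<and> diameter (U k) \<le> \<delta>)}"

definition hausdorff_measure :: "real \<Rightarrow> 'a::metric_space set \<Rightarrow> ennreal" where
  "hausdorff_measure s G = (SUP \<delta>\<in>{0<..}. hausdorff_premeasure s \<delta> G)"

definition hausdorff_dim :: "'a::metric_space set \<Rightarrow> ereal" where
  "hausdorff_dim G = Inf {ereal s | s. 0 \<le> s \<and> hausdorff_measure s G = 0}"


section \<open>Porosity\<close>

text \<open>
  Balls are open, so that \<open>c = 0\<close> is always admissible; with closed balls the supremum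
  is the same whenever some \<open>c > 0\<close> is admissible.
\<close>

definition por :: "'a::metric_space set \<Rightarrow> 'a \<Rightarrow> real \<Rightarrow> real" where
  "por G x r = Sup {c. 0 \<le> c \<and> (\<exists>y. ball y (c * r) \<subseteq> ball x r - G)}"

definition c_porous_at :: "real \<Rightarrow> 'a::metric_space set \<Rightarrow> 'a \<Rightarrow> bool" where
  "c_porous_at c G x \<longleftrightarrow> (\<exists>r0>0. \<forall>r\<in>{0<..<r0}. c \<le> por G x r)"

definition porous_at :: "'a::metric_space set \<Rightarrow> 'a \<Rightarrow> bool" where
  "porous_at G x \<longleftrightarrow> (\<exists>c\<in>{0<..<1}. c_porous_at c G x)"


section \<open>Graph directed Markov systems\<close>

text \<open>
  The fields are the vertex set, the alphabet, the incidence matrix (as a relation), the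
  terminal and initial vertex maps \<open>t\<close> and \<open>i\<close>, the spaces \<open>X\<^sub>v\<close> (as subsets of one ambient
  space) and the maps \<open>\<phi>\<^sub>e\<close>. Only the values on the relevant carriers matter: \<open>inc\<close>, \<open>tm\<close>,
  \<open>im\<close>, \<open>phi\<close> on the alphabet, \<open>sp\<close> on the vertex set and \<open>phi G e\<close> on \<open>sp G (tm G e)\<close>.
\<close>

record ('v, 'e, 'a) gdms =
  verts :: "'v set"
  edges :: "'e set"
  inc :: "'e \<Rightarrow> 'e \<Rightarrow> bool"
  tm :: "'e \<Rightarrow> 'v"
  im :: "'e \<Rightarrow> 'v"
  sp :: "'v \<Rightarrow> 'a set"
  phi :: "'e \<Rightarrow> 'a \<Rightarrow> 'a"

definition is_gdms :: "('v, 'e, 'a::metric_space) gdms \<Rightarrow> bool" where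
  "is_gdms G \<longleftrightarrow>
     finite (verts G) \<and>
     countable (edges G) \<and>
     (\<exists>a\<in>edges G. \<exists>b\<in>edges G. a \<noteq> b) \<and>
     (\<forall>e\<in>edges G. tm G e \<in> verts G \<and> im G e \<in> verts G) \<and>
     (\<forall>a\<in>edges G. \<forall>b\<in>edges G. inc G a b \<longrightarrow> tm G a = im G b) \<and>
     (\<forall>v\<in>verts G. sp G v \<noteq> {} \<and> compact (sp G v)) \<and>
     (\<forall>e\<in>edges G. phi G e ` sp G (tm G e) \<subseteq> sp G (im G e) \<and>
                   inj_on (phi G e) (sp G (tm G e))) \<and>
     (\<exists>s. 0 < s \<and> s < 1 \<and> (\<forall>e\<in>edges G. s-lipschitz_on (sp G (tm G e)) (phi G e))) \<and>
     (\<forall>v\<in>verts G. \<exists>e\<in>edges G. \<exists>e'\<in>edges G. tm G e = v \<and> im G e' = v)"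

definition words :: "('v, 'e, 'a) gdms \<Rightarrow> 'e list set" where
  "words G = {w. set w \<subseteq> edges G \<and> successively (inc G) w}"

definition infinite_words :: "('v, 'e, 'a) gdms \<Rightarrow> (nat \<Rightarrow> 'e) set" where
  "infinite_words G = {w. \<forall>k. w k \<in> edges G \<and> inc G (w k) (w (Suc k))}"

definition finitely_irreducible :: "('v, 'e, 'a) gdms \<Rightarrow> bool" where
  "finitely_irreducible G \<longleftrightarrow>
     (\<exists>L. finite L \<and> L \<subseteq> words G \<and>
       (\<forall>a\<in>edges G. \<forall>b\<in>edges G. \<exists>w\<in>L. a # w @ [b] \<in> words G))"

text \<open>The composition \<open>f\<^bsub>w\<^sub>1\<^esub> \<circ> \<dots> \<circ> f\<^bsub>w\<^sub>n\<^esub>\<close>.\<close>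

definition word_map :: "('e \<Rightarrow> 'a \<Rightarrow> 'a) \<Rightarrow> 'e list \<Rightarrow> 'a \<Rightarrow> 'a" where
  "word_map f w = foldr f w"

text \<open>
  Infinite words are indexed from \<open>0\<close>; the prefix \<open>\<omega>|\<^bsub>n+1\<^esub>\<close> ends in the letter \<open>w n\<close>.
\<close>

definition coding :: "('v, 'e, 'a) gdms \<Rightarrow> (nat \<Rightarrow> 'e) \<Rightarrow> 'a" where
  "coding G w =
     (THE x. (\<Inter>n. word_map (phi G) (map w [0..<Suc n]) ` sp G (tm G (w n))) = {x})"

definition limit_set :: "('v, 'e, 'a) gdms \<Rightarrow> 'a set" where
  "limit_set G = coding G ` infinite_words G"

definition total_space :: "('v, 'e, 'a) gdms \<Rightarrow> 'a set" where
  "total_space G = (\<Union>v\<in>verts G. sp G v)"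

definition fixed_points :: "('v, 'e, 'a) gdms \<Rightarrow> 'a set" where
  "fixed_points G =
     {x. \<exists>w. w \<noteq> [] \<and> w \<in> words G \<and> w @ w \<in> words G \<and>
       (\<Inter>n\<in>{1..}. word_map (phi G) (concat (replicate n w)) ` sp G (tm G (last w))) = {x}}"

text \<open>
  The system \<open>{\<phi>\<^sub>e}\<^bsub>e\<in>F\<^esub>\<close>, with unchanged vertices: its infinite words are those of \<open>G\<close> with
  all letters in \<open>F\<close>.
\<close>

definition subsystem :: "('v, 'e, 'a) gdms \<Rightarrow> 'e set \<Rightarrow> ('v, 'e, 'a) gdms" where
  "subsystem G F = G\<lparr>edges := F\<rparr>"


section \<open>Conformal systems\<close>

definition C1_on :: "'a::real_normed_vector set \<Rightarrow> ('a \<Rightarrow> 'a) \<Rightarrow> bool" where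
  "C1_on W f \<longleftrightarrow>
     (\<exists>D :: 'a \<Rightarrow> 'a \<Rightarrow>\<^sub>L 'a.
        (\<forall>x\<in>W. (f has_derivative blinfun_apply (D x)) (at x)) \<and> continuous_on W D)"

definition similarity_map :: "('a::real_normed_vector \<Rightarrow> 'a) \<Rightarrow> bool" where
  "similarity_map L \<longleftrightarrow> linear L \<and> (\<exists>c>0. \<forall>h. norm (L h) = c * norm h)"

definition conformal_diffeo_into ::
    "'a::real_normed_vector set \<Rightarrow> 'a set \<Rightarrow> ('a \<Rightarrow> 'a) \<Rightarrow> bool" where
  "conformal_diffeo_into W W' f \<longleftrightarrow>
     f ` W \<subseteq> W' \<and> open (f ` W) \<and> C1_on W f \<and>
     (\<exists>g. C1_on (f ` W) g \<and> (\<forall>x\<in>W. g (f x) = x)) \<and>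
     (\<forall>x\<in>W. similarity_map (frechet_derivative f (at x)))"

text \<open>\<open>f e\<close> is the conformal extension of \<open>\<phi>\<^sub>e\<close> to the neighbourhood \<open>W (t e)\<close> of \<open>X (t e)\<close>.\<close>

definition conformal_extension ::
    "('v, 'e, 'a::real_normed_vector) gdms \<Rightarrow> ('v \<Rightarrow> 'a set) \<Rightarrow> ('e \<Rightarrow> 'a \<Rightarrow> 'a) \<Rightarrow> bool" where
  "conformal_extension G W f \<longleftrightarrow>
     (\<forall>v\<in>verts G. open (W v) \<and> connected (W v) \<and> sp G v \<subseteq> W v) \<and>
     (\<forall>e\<in>edges G. (\<forall>x\<in>sp G (tm G e). f e x = phi G e x) \<and>
                   conformal_diffeo_into (W (tm G e)) (W (im G e)) (f e))"

text \<open>The operator norm of the derivative of \<open>f\<^bsub>w\<^sub>1\<^esub> \<circ> \<dots> \<circ> f\<^bsub>w\<^sub>n\<^esub>\<close> at \<open>p\<close>.\<close>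

definition deriv_norm ::
    "('e \<Rightarrow> 'a \<Rightarrow> 'a) \<Rightarrow> 'e list \<Rightarrow> 'a::real_normed_vector \<Rightarrow> real" where
  "deriv_norm f w p = onorm (frechet_derivative (word_map f w) (at p))"

definition bounded_distortion ::
    "('v, 'e, 'a::real_normed_vector) gdms \<Rightarrow> ('v \<Rightarrow> 'a set) \<Rightarrow> ('e \<Rightarrow> 'a \<Rightarrow> 'a) \<Rightarrow> bool" where
  "bounded_distortion G S f \<longleftrightarrow>
     (\<exists>\<alpha>>0. \<exists>K\<ge>1. \<forall>w\<in>words G. w \<noteq> [] \<longrightarrow>
       (\<forall>p\<in>S (tm G (last w)). \<forall>q\<in>S (tm G (last w)).
          \<bar>deriv_norm f w p / deriv_norm f w q - 1\<bar> \<le> K * norm (p - q) powr \<alpha> \<and>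
          1 / K \<le> deriv_norm f w p / deriv_norm f w q \<and>
          deriv_norm f w p / deriv_norm f w q \<le> K))"

text \<open>
  The standing assumptions (compact neighbourhoods \<open>S v\<close>, bounded distortion) are included.
  As the \<open>S v\<close> are pairwise disjoint, \<open>total_space\<close> is the disjoint union of the \<open>sp G v\<close>.
\<close>

definition conformal_gdms :: "('v, 'e, real ^ 'n) gdms \<Rightarrow> bool" where
  "conformal_gdms G \<longleftrightarrow>
     is_gdms G \<and>
     (\<forall>v\<in>verts G. connected (sp G v) \<and> sp G v = closure (interior (sp G v))) \<and>
     (\<forall>a\<in>edges G. \<forall>b\<in>edges G. a \<noteq> b \<longrightarrow>
        phi G a ` interior (sp G (tm G a)) \<inter> phi G b ` interior (sp G (tm G b)) = {}) \<and>
     (\<exists>W f S.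
        conformal_extension G W f \<and>
        (\<forall>v\<in>verts G. compact (S v) \<and> sp G v \<subseteq> interior (S v) \<and> S v \<subseteq> W v) \<and>
        disjoint_family_on S (verts G) \<and>
        bounded_distortion G S f)"

end

theory Submission
  imports Defs "HOL-Library.Sublist"
begin

text \<open>A gap in the first-level images gives a ball \<open>B\<close> in some \<open>X\<^sub>v\<close> that misses the limit set,
  and by the open set condition every image \<open>\<phi>\<^sub>\<omega>(B)\<close> misses it as well. By bounded distortion
  \<open>\<phi>\<^sub>\<omega>(B)\<close> contains a ball whose radius is comparable to the diameter of \<open>\<phi>\<^sub>\<omega>(X)\<close>. If the
  letters of the coding of a point come from a finite set, then finite irreducibility yields such
  a hole at every scale, with uniform constants; this covers the fixed points.

  For the dimension, let \<open>t < dim J\<close>. The sums of \<open>\<parallel>D\<phi>\<^sub>\<omega>\<parallel>\<^sup>t\<close> over words of length \<open>n\<close> cannot stay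
  bounded, for otherwise the natural covers would give \<open>dim J \<le> t\<close>. So some finite set of words of
  one length has a large sum; closing these words up to cycles through one letter produces a finite
  iterated function system, and the mass distribution principle bounds the dimension of its limit
  set from below by \<open>t\<close>.\<close>

text \<open>Over an infinite alphabet one further letter may shrink an image by an arbitrarily large
  factor, and no hole of comparable size need be visible at the scales in between. Porosity is
  therefore proved only at points coded by finitely many letters, and these must be shown to be
  dense and to carry the full dimension. Derivative bounds cannot be integrated inside the
  \<open>sp G v\<close>, which need not be convex: diameters need a chain argument in the
  neighbourhoods \<open>S v\<close>, inner radii a quantitative inverse function argument. One
  number \<open>D w\<close>, the derivative norm at a base point, then controls both up to
  constants. The lower dimension bound uses neither pressure nor an invariant measure. Weights on
  finite words replace a measure on infinite words. \<open>D\<close> is multiplicative only up to a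
  factor \<open>K\<close> per block, and the large sum absorbs this loss. The dimension is a value
  in \<open>ereal\<close>; were it infinite, the strict inequality in (ii) would be false. A crude
  volume bound excludes this.\<close>

section \<open>Hausdorff dimension and volume\<close>

text \<open>\<open>Sup\<close> on the reals is an upper bound only for a set bounded above. In a
  euclidean space a ball inside \<open>ball x r\<close> has radius at most \<open>r\<close>, so no
  candidate exceeds 1; in a general metric space this can fail.\<close>

lemma por_ge:
  fixes x y :: "'a::euclidean_space"
  assumes "0 \<le> c" "0 < r" "ball y (c * r) \<subseteq> ball x r - A"
  shows "c \<le> por A x r"
  unfolding por_def
proof (rule cSup_upper)
  show "c \<in> {c. 0 \<le> c \<and> (\<exists>y. ball y (c * r) \<subseteq> ball x r - A)}"
    using assms by auto
  have "d \<le> 1" if "ball z (d * r) \<subseteq> ball x r" for d z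
  proof -
    have "d * r \<le> 0 \<or> d * r \<le> r"
      using that zero_le_dist[of z x] unfolding ball_subset_ball_iff by linarith
    with \<open>0 < r\<close> show ?thesis by (auto simp: mult_le_0_iff)
  qed
  then show "bdd_above {c. 0 \<le> c \<and> (\<exists>y. ball y (c * r) \<subseteq> ball x r - A)}"
    by (intro bdd_aboveI[of _ 1]) blast
qed

lemma hausdorff_dim_nonneg: "0 \<le> hausdorff_dim A"
  unfolding hausdorff_dim_def by (rule Inf_greatest) auto

lemma hausdorff_dim_le:
  assumes "0 \<le> s" "hausdorff_measure s A = 0"
  shows "hausdorff_dim A \<le> ereal s"
  unfolding hausdorff_dim_def using assms by (auto intro: Inf_lower)

lemma hausdorff_premeasure_mono:
  assumes "A \<subseteq> B"
  shows "hausdorff_premeasure s \<delta> A \<le> hausdorff_premeasure s \<delta> B"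
  unfolding hausdorff_premeasure_def using assms by (intro Inf_superset_mono) blast

lemma hausdorff_measure_mono:
  assumes "A \<subseteq> B"
  shows "hausdorff_measure s A \<le> hausdorff_measure s B"
  unfolding hausdorff_measure_def
  using hausdorff_premeasure_mono[OF assms] by (intro SUP_mono) blast

lemma hausdorff_dim_mono:
  assumes "A \<subseteq> B"
  shows "hausdorff_dim A \<le> hausdorff_dim B"
  unfolding hausdorff_dim_def
  using hausdorff_measure_mono[OF assms] by (intro Inf_superset_mono Collect_mono) (metis le_zero_eq)

lemma diam_pow_le_ennreal:
  assumes "0 < s" "diameter U \<le> d" "0 \<le> d" "bounded U"
  shows "diam_pow s U \<le> ennreal (d powr s)"
  using assms diameter_ge_0[OF \<open>bounded U\<close>]
  by (auto simp: diam_pow_def intro!: ennreal_leI powr_mono2)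

lemma diam_pow_antimono:
  assumes "bounded U" "diameter U \<le> 1" "0 \<le> s" "s \<le> t"
  shows "diam_pow t U \<le> diam_pow s U"
proof -
  have "diameter U powr t \<le> diameter U powr s"
    using assms diameter_ge_0[OF \<open>bounded U\<close>] by (intro powr_mono') auto
  \<comment> \<open>This covers \<open>s = 0 < t\<close>, where \<open>diam_pow s U\<close> is 1 by
    convention and not a power of the diameter.\<close>
  moreover have "diameter U powr t \<le> 1"
    using assms diameter_ge_0[OF \<open>bounded U\<close>] by (intro powr_le1) auto
  ultimately show ?thesis
    using assms by (auto simp: diam_pow_def)
qed

text \<open>Covers in the definition are indexed by \<open>nat\<close>, the natural covers by words.
  Indices that code nothing get the empty set, which contributes 0. Bounding finite subsums avoids
  sums over an infinite alphabet.\<close>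

lemma hausdorff_premeasure_le_finite_sums:
  fixes U :: "'i \<Rightarrow> 'a::metric_space set"
  assumes "countable I" "A \<subseteq> (\<Union>i\<in>I. U i)" "0 \<le> \<delta>"
    and U: "\<And>i. i \<in> I \<Longrightarrow> bounded (U i)" "\<And>i. i \<in> I \<Longrightarrow> diameter (U i) \<le> \<delta>"
    and M: "\<And>B. finite B \<Longrightarrow> B \<subseteq> I \<Longrightarrow> (\<Sum>i\<in>B. diam_pow s (U i)) \<le> M"
  shows "hausdorff_premeasure s \<delta> A \<le> M"
proof -
  define V where "V k = (if k \<in> to_nat_on I ` I then U (from_nat_into I k) else {})" for k
  have V: "V (to_nat_on I i) = U i" if "i \<in> I" for i
    using that \<open>countable I\<close> by (simp add: V_def)
  have "A \<subseteq> (\<Union>k. V k)"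
  proof
    fix x assume "x \<in> A"
    then obtain i where "i \<in> I" "x \<in> U i" using assms(2) by blast
    then show "x \<in> (\<Union>k. V k)" by (intro UN_I[of "to_nat_on I i"]) (simp_all add: V)
  qed
  moreover have "bounded (V k) \<and> diameter (V k) \<le> \<delta>" for k
    using U V \<open>0 \<le> \<delta>\<close> by (cases "k \<in> to_nat_on I ` I") (auto simp: V_def)
  ultimately have "hausdorff_premeasure s \<delta> A \<le> (\<Sum>k. diam_pow s (V k))"
    unfolding hausdorff_premeasure_def by (intro Inf_lower CollectI exI[of _ V]) simp
  also have "\<dots> \<le> M"
  proof (rule suminf_le_const[OF summableI])
    fix m
    define B where "B = {i \<in> I. to_nat_on I i < m}"
    have inj: "inj_on (to_nat_on I) B"
      using inj_on_to_nat_on[OF \<open>countable I\<close>] by (rule inj_on_subset) (auto simp: B_def)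
    have "finite B"
      by (rule inj_on_finite[OF inj, of "{..<m}"]) (auto simp: B_def)
    have "(\<Sum>k<m. diam_pow s (V k)) = (\<Sum>k\<in>to_nat_on I ` B. diam_pow s (V k))"
      by (rule sum.mono_neutral_right) (auto simp: B_def V_def diam_pow_def)
    also have "\<dots> = (\<Sum>i\<in>B. diam_pow s (U i))"
      unfolding sum.reindex[OF inj] by (rule sum.cong) (auto simp: V B_def)
    also have "\<dots> \<le> M"
      using \<open>finite B\<close> by (intro M) (auto simp: B_def)
    finally show "(\<Sum>k<m. diam_pow s (V k)) \<le> M" .
  qed
  finally show ?thesis .
qed

text \<open>Packing by Lebesgue measure; the volume of the unit ball cancels. It later counts the
  pieces that meet a covering set and bounds the sums of \<open>D w ^ CARD('n)\<close>.\<close>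

lemma sum_disjoint_balls_le:
  fixes z :: "'i \<Rightarrow> 'a::euclidean_space"
  assumes "finite A" "disjoint_family_on (\<lambda>a. ball (z a) (\<rho> a)) A"
    and \<rho>: "\<And>a. a \<in> A \<Longrightarrow> 0 \<le> \<rho> a"
    and sub: "\<And>a. a \<in> A \<Longrightarrow> ball (z a) (\<rho> a) \<subseteq> ball x R" and "0 \<le> R"
  shows "(\<Sum>a\<in>A. \<rho> a ^ DIM('a)) \<le> R ^ DIM('a)"
proof -
  define V where "V = unit_ball_vol (real DIM('a))"
  have "V > 0" by (simp add: V_def)
  have "(\<Sum>a\<in>A. ennreal (V * \<rho> a ^ DIM('a))) = (\<Sum>a\<in>A. emeasure lborel (ball (z a) (\<rho> a)))"
    using \<rho> by (intro sum.cong) (simp_all add: emeasure_ball V_def)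
  also have "\<dots> = emeasure lborel (\<Union>a\<in>A. ball (z a) (\<rho> a))"
    using assms by (intro sum_emeasure) auto
  also have "\<dots> \<le> emeasure lborel (ball x R)"
    using sub by (intro emeasure_mono) auto
  also have "\<dots> = ennreal (V * R ^ DIM('a))"
    using \<open>0 \<le> R\<close> by (simp add: emeasure_ball V_def)
  finally have "ennreal (\<Sum>a\<in>A. V * \<rho> a ^ DIM('a)) \<le> ennreal (V * R ^ DIM('a))"
    using \<rho> \<open>V > 0\<close> by (subst (asm) sum_ennreal) auto
  then have "V * (\<Sum>a\<in>A. \<rho> a ^ DIM('a)) \<le> V * R ^ DIM('a)"
    using \<open>V > 0\<close> \<open>0 \<le> R\<close> by (subst (asm) ennreal_le_iff) (auto simp: sum_distrib_left)
  then show ?thesis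
    using \<open>V > 0\<close> by simp
qed

section \<open>Oscillation and expansion of maps\<close>

text \<open>Points of a connected set are joined by chains with links shorter than \<delta>, and
  compactness bounds the number of links. The number is chosen before \<open>h\<close>, so one
  \<open>N\<close> serves infinitely many word maps at once; hence \<open>h\<close> is quantified
  inside \<open>R\<close>.\<close>

lemma compact_connected_oscillation_bound:
  fixes X :: "'a::metric_space set"
  assumes "compact X" "connected X" "\<delta> > 0"
  obtains N where "0 \<le> N"
    "\<And>(h :: 'a \<Rightarrow> 'b::metric_space) c p q. \<lbrakk>\<And>p q. p \<in> X \<Longrightarrow> q \<in> X \<Longrightarrow> dist p q < \<delta> \<Longrightarrow> dist (h p) (h q) \<le> c;
       p \<in> X; q \<in> X\<rbrakk> \<Longrightarrow> dist (h p) (h q) \<le> N * c"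
proof -
  define good where "good h c \<longleftrightarrow> (\<forall>p\<in>X. \<forall>q\<in>X. dist p q < \<delta> \<longrightarrow> dist (h p) (h q) \<le> c)"
    for h :: "'a \<Rightarrow> 'b" and c
  define R where "R p q \<longleftrightarrow> (\<exists>n::nat. \<forall>h c. good h c \<longrightarrow> dist (h p) (h q) \<le> n * c)" for p q
  have R_close: "R p q" if "p \<in> X" "q \<in> X" "dist p q < \<delta>" for p q
    unfolding R_def good_def using that by (intro exI[of _ 1]) auto
  have R_trans: "R p q" if "R p z" "R z q" for p q z
  proof -
    from that obtain n m :: nat where n: "\<And>h c. good h c \<Longrightarrow> dist (h p) (h z) \<le> real n * c"
      and m: "\<And>h c. good h c \<Longrightarrow> dist (h z) (h q) \<le> real m * c"
      unfolding R_def by blast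
    have "dist (h p) (h q) \<le> (real n + real m) * c" if "good h c" for h c
      using n[OF that] m[OF that] dist_triangle[of "h p" "h q" "h z"] by (simp add: algebra_simps)
    then show ?thesis
      unfolding R_def by (metis of_nat_add)
  qed
  \<comment> \<open>The classes of \<open>R\<close> are relatively open, so a connected set has only
    one.\<close>
  have R_all: "R p q" if "p \<in> X" "q \<in> X" for p q
  proof (rule connected_equivalence_relation[OF \<open>connected X\<close> that])
    show "R y x" if "R x y" for x y
      using that unfolding R_def by (simp add: dist_commute)
    show "\<exists>T. openin (top_of_set X) T \<and> a \<in> T \<and> (\<forall>x\<in>T. R a x)" if "a \<in> X" for a
      using that \<open>\<delta> > 0\<close> R_close
      by (intro exI[of _ "X \<inter> ball a \<delta>"]) (auto simp: openin_open)
  qed (rule R_trans)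
  show ?thesis
  proof (cases "X = {}")
    case True
    then show ?thesis by (intro that[of 0]) auto
  next
    case False
    then obtain x0 where "x0 \<in> X" by blast
    obtain C where C: "finite C" "C \<subseteq> X" "X \<subseteq> (\<Union>x\<in>C. ball x \<delta>)"
    proof (rule compactE_image[OF \<open>compact X\<close>, of X "\<lambda>x. ball x \<delta>"])
      show "X \<subseteq> (\<Union>x\<in>X. ball x \<delta>)"
      proof
        fix x assume "x \<in> X"
        with \<open>\<delta> > 0\<close> show "x \<in> (\<Union>x\<in>X. ball x \<delta>)" by (intro UN_I[of x]) simp_all
      qed
    qed auto
    obtain n :: "'a \<Rightarrow> nat" where n: "\<And>x h c. x \<in> X \<Longrightarrow> good h c \<Longrightarrow> dist (h x0) (h x) \<le> real (n x) * c"
      using R_all[OF \<open>x0 \<in> X\<close>] unfolding R_def by metis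
    \<comment> \<open>The sum bounds every chain from \<open>x0\<close> to a net point; the extra 1
      is the last link from a net point to \<open>q\<close>.\<close>
    define N where "N = real (\<Sum>x\<in>C. n x) + 1"
    have *: "dist (h x0) (h q) \<le> N * c" if "q \<in> X" "good h c" for h q c
    proof -
      obtain x where x: "x \<in> C" "dist x q < \<delta>"
        using C(3) \<open>q \<in> X\<close> by auto
      have "0 \<le> c"
        using \<open>good h c\<close> \<open>x0 \<in> X\<close> \<open>\<delta> > 0\<close> unfolding good_def by fastforce
      have "n x \<le> (\<Sum>x\<in>C. n x)"
        using x(1) C(1) by (simp add: member_le_sum)
      then have "real (n x) + 1 \<le> N" unfolding N_def by linarith
      have "dist (h x0) (h x) \<le> real (n x) * c" "dist (h x) (h q) \<le> c"
        using n[of x h c] x C(2) that unfolding good_def by blast+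
      then have "dist (h x0) (h q) \<le> real (n x) * c + c"
        using dist_triangle[of "h x0" "h q" "h x"] by linarith
      also have "\<dots> \<le> N * c"
        using mult_right_mono[OF \<open>real (n x) + 1 \<le> N\<close> \<open>0 \<le> c\<close>] by (simp add: algebra_simps)
      finally show ?thesis .
    qed
    show ?thesis
    proof (rule that[of "2 * N"])
      show "0 \<le> 2 * N" unfolding N_def by (simp del: of_nat_sum)
      fix h :: "'a \<Rightarrow> 'b" and c p q
      assume "\<And>p q. p \<in> X \<Longrightarrow> q \<in> X \<Longrightarrow> dist p q < \<delta> \<Longrightarrow> dist (h p) (h q) \<le> c" "p \<in> X" "q \<in> X"
      then have "good h c" by (simp add: good_def)
      from *[OF \<open>p \<in> X\<close> this] *[OF \<open>q \<in> X\<close> this] show "dist (h p) (h q) \<le> 2 * N * c"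
        using dist_triangle3[of "h p" "h q" "h x0"] by simp
    qed
  qed
qed

text \<open>Follow the segment from \<open>h y\<close> to \<open>q\<close> up to the first point outside the image; before that
  point the local inverse is \<open>1/m\<close>-Lipschitz, hence stays in a compact part of the ball.\<close>

lemma ball_subset_image_of_expanding_derivative:
  fixes h :: "'a::euclidean_space \<Rightarrow> 'a"
  assumes der: "\<And>x. x \<in> ball y \<rho> \<Longrightarrow> (h has_derivative h' x) (at x)"
    and exp: "\<And>x v. x \<in> ball y \<rho> \<Longrightarrow> m * norm v \<le> norm (h' x v)"
    and "0 < m" and inj: "inj_on h (ball y \<rho>)" and "0 < \<rho>"
  shows "ball (h y) (m * \<rho>) \<subseteq> h ` ball y \<rho>"
proof
  fix q assume q: "q \<in> ball (h y) (m * \<rho>)"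
  define U where "U = h ` ball y \<rho>"
  define g where "g = the_inv_into (ball y \<rho>) h"
  have gh: "g (h x) = x" if "x \<in> ball y \<rho>" for x
    unfolding g_def using inj that by (rule the_inv_into_f_f)
  have cont: "continuous_on (ball y \<rho>) h"
    using der by (meson continuous_at_imp_continuous_on has_derivative_continuous)
  have "open U"
    unfolding U_def using cont inj by (intro invariance_of_domain) auto
  have lin: "linear (h' x)" if "x \<in> ball y \<rho>" for x
    using der[OF that] by (rule has_derivative_linear)
  have injh': "inj (h' x)" if "x \<in> ball y \<rho>" for x
    unfolding linear_injective_0[OF lin[OF that]]
    using exp[OF that] \<open>0 < m\<close> by (metis mult_le_0_iff norm_le_zero_iff not_less norm_zero)
  define g' where "g' x = inv (h' x)" for x
  have left: "g' x (h' x v) = v" if "x \<in> ball y \<rho>" for x v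
    unfolding g'_def using injh'[OF that] by (rule inv_f_f)
  have right: "h' x (g' x v) = v" if "x \<in> ball y \<rho>" for x v
    unfolding g'_def using linear_injective_imp_surjective[OF lin injh'] that by (simp add: surj_f_inv_f)
  have g_der: "(g has_derivative g' x) (at (h x))" if "x \<in> ball y \<rho>" for x
  proof (rule has_derivative_inverse_on[where S = "ball y \<rho>" and f' = h' and g' = g' and x = x])
    show "h' x \<circ> g' x = id"
      using right[OF that] by (simp add: fun_eq_iff)
  qed (use der gh that in auto)
  have g'_bd: "onorm (g' x) \<le> 1 / m" if "x \<in> ball y \<rho>" for x
  proof (rule onorm_le)
    fix v
    have "m * norm (g' x v) \<le> norm v"
      using exp[OF that, of "g' x v"] right[OF that] by simp
    then show "norm (g' x v) \<le> 1 / m * norm v"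
      using \<open>0 < m\<close> by (simp add: field_simps)
  qed
  define \<gamma> where "\<gamma> t = h y + t *\<^sub>R (q - h y)" for t :: real
  have [continuous_intros]: "continuous_on T \<gamma>" for T
    unfolding \<gamma>_def by (intro continuous_intros)
  show "q \<in> h ` ball y \<rho>"
  proof (rule ccontr)
    assume "q \<notin> h ` ball y \<rho>"
    define B where "B = {0..1} \<inter> \<gamma> -` (- U)"
    have "compact B"
      unfolding B_def compact_eq_bounded_closed using \<open>open U\<close>
      by (intro conjI continuous_closed_preimage continuous_intros bounded_Int) auto
    moreover have "1 \<in> B"
      using \<open>q \<notin> h ` ball y \<rho>\<close> by (simp add: B_def \<gamma>_def U_def)
    ultimately obtain t0 where "t0 \<in> B" and t0: "\<And>t. t \<in> B \<Longrightarrow> t0 \<le> t"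
      using compact_attains_inf[of B] by blast
    then have "0 \<le> t0" "t0 \<le> 1" "\<gamma> t0 \<notin> U"
      by (auto simp: B_def)
    moreover have "\<gamma> 0 \<in> U"
      using \<open>0 < \<rho>\<close> by (simp add: \<gamma>_def U_def)
    ultimately have "0 < t0"
      by (metis less_eq_real_def)
    have \<gamma>U: "\<gamma> t \<in> U" if "t \<in> {0..<t0}" for t
      using t0[of t] that \<open>t0 \<le> 1\<close> by (force simp: B_def)
    \<comment> \<open>The lifted path \<open>g (\<gamma> t)\<close> has speed at most
      \<open>r0\<close>, so up to time 1 it stays in \<open>cball y r0\<close>, whose radius is
      strictly smaller than \<rho>.\<close>
    define r0 where "r0 = norm (q - h y) / m"
    have "r0 < \<rho>" "0 \<le> r0"
      using q \<open>0 < m\<close> by (simp_all add: r0_def field_simps dist_norm norm_minus_commute)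
    have "g (\<gamma> t) \<in> cball y r0" if "t \<in> {0..<t0}" for t
    proof -
      have "norm (g (\<gamma> t) - g (\<gamma> 0)) \<le> r0 * norm (t - 0)"
      proof (rule differentiable_bound[where S = "{0..<t0}"
            and f' = "\<lambda>s v. g' (g (\<gamma> s)) (v *\<^sub>R (q - h y))"])
        fix s assume "s \<in> {0..<t0}"
        then obtain x where x: "x \<in> ball y \<rho>" "\<gamma> s = h x"
          using \<gamma>U U_def by blast
        have "(\<gamma> has_derivative (\<lambda>v. v *\<^sub>R (q - h y))) (at s within {0..<t0})"
          unfolding \<gamma>_def by (auto intro!: derivative_eq_intros)
        moreover have "(g has_derivative g' (g (\<gamma> s))) (at (\<gamma> s))"
          using g_der[OF x(1)] x gh by simp
        ultimately show "((\<lambda>s. g (\<gamma> s)) has_derivative (\<lambda>v. g' (g (\<gamma> s)) (v *\<^sub>R (q - h y))))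
            (at s within {0..<t0})"
          by (rule has_derivative_compose)
        show "onorm (\<lambda>v. g' (g (\<gamma> s)) (v *\<^sub>R (q - h y))) \<le> r0"
        proof (rule onorm_le)
          fix v :: real
          have "bounded_linear (g' x)"
            using g_der[OF x(1)] by (rule has_derivative_bounded_linear)
          then have "norm (g' x (v *\<^sub>R (q - h y))) \<le> onorm (g' x) * norm (v *\<^sub>R (q - h y))"
            by (rule onorm)
          also have "\<dots> \<le> 1 / m * norm (v *\<^sub>R (q - h y))"
            by (intro mult_right_mono g'_bd x) auto
          finally show "norm (g' (g (\<gamma> s)) (v *\<^sub>R (q - h y))) \<le> r0 * norm v"
            using x gh by (simp add: r0_def mult.commute)
        qed
      qed (use that \<open>0 < t0\<close> in auto)
      also have "\<dots> \<le> r0 * 1"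
        using that \<open>t0 \<le> 1\<close> \<open>0 \<le> r0\<close> by (intro mult_left_mono) auto
      finally show ?thesis
        using gh[of y] \<open>0 < \<rho>\<close> by (simp add: \<gamma>_def dist_norm norm_minus_commute)
    qed
    moreover have "h (g (\<gamma> t)) = \<gamma> t" if "t \<in> {0..<t0}" for t
      using \<gamma>U[OF that] gh unfolding U_def by (metis imageE)
    ultimately have "\<gamma> t \<in> h ` cball y r0" if "t \<in> {0..<t0}" for t
      using that by (metis image_eqI)
    then have img: "\<gamma> ` {0..<t0} \<subseteq> h ` cball y r0"
      by blast
    have sub: "cball y r0 \<subseteq> ball y \<rho>"
      using \<open>r0 < \<rho>\<close> by auto
    \<comment> \<open>The image of the compact ball is closed, so it also contains the limit point
      \<open>\<gamma> t0\<close>, against the choice of \<open>t0\<close>.\<close>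
    then have "closed (h ` cball y r0)"
      using cont by (intro compact_imp_closed compact_continuous_image) (auto intro: continuous_on_subset)
    moreover have "continuous_on (closure {0..<t0}) \<gamma>"
      by (intro continuous_intros)
    ultimately have "\<gamma> ` closure {0..<t0} \<subseteq> h ` cball y r0"
      using img by (metis image_closure_subset)
    moreover have "t0 \<in> closure {0..<t0}"
      using \<open>0 < t0\<close> by simp
    ultimately have "\<gamma> t0 \<in> h ` cball y r0"
      by (metis image_eqI subsetD)
    then have "\<gamma> t0 \<in> U"
      using sub unfolding U_def by (metis image_mono subsetD)
    with \<open>\<gamma> t0 \<notin> U\<close> show False ..
  qed
qed

section \<open>Mass distribution on trees of words\<close>

text \<open>If the cylinders of \<open>T\<close> had total mass below \<open>1\<close>, one could choose letters one by one such
  that the part of \<open>T\<close> below the current word always has less mass than the word itself.\<close>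

lemma bar_mass_ge_1:
  fixes p :: "'i \<Rightarrow> ennreal"
  assumes "finite I" "sum p I = 1" "T \<subseteq> lists I"
    and bar: "\<And>w. (\<And>n. w n \<in> I) \<Longrightarrow> \<exists>n. map w [0..<n] \<in> T"
  shows "1 \<le> emeasure (point_measure UNIV (\<lambda>u. prod_list (map p u))) T"
proof (rule ccontr)
  define P where "P u = prod_list (map p u)" for u
  \<comment> \<open>\<open>M\<close> weights all finite words at once: each level of the tree over
    \<open>I\<close> has mass 1 by itself, and \<open>T\<close> may contain words from all
    levels.\<close>
  define M where "M = point_measure UNIV P"
  define m where "m u = emeasure M {v \<in> T. prefix u v}" for u
  have sets_M: "sets M = UNIV"
    by (simp add: M_def sets_point_measure)
  assume "\<not> 1 \<le> emeasure (point_measure UNIV (\<lambda>u. prod_list (map p u))) T"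
  then have start: "m [] < P []"
    by (simp add: m_def M_def P_def[abs_def])
  \<comment> \<open>A word with \<open>m u < P u\<close> is therefore not in \<open>T\<close>, so
    every word of \<open>T\<close> below it runs through exactly one child.\<close>
  have P_le_m: "P u \<le> m u" if "u \<in> T" for u
  proof -
    have "P u = emeasure M {u}"
      by (simp add: M_def emeasure_point_measure_finite2)
    also have "\<dots> \<le> m u"
      unfolding m_def using that by (intro emeasure_mono) (auto simp: sets_M)
    finally show ?thesis .
  qed
  have step: "\<exists>i\<in>I. m (u @ [i]) < P (u @ [i])" if "m u < P u" for u
  proof (rule ccontr)
    assume "\<not> (\<exists>i\<in>I. m (u @ [i]) < P (u @ [i]))"
    then have "(\<Sum>i\<in>I. P (u @ [i])) \<le> (\<Sum>i\<in>I. m (u @ [i]))"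
      by (intro sum_mono) (auto simp: not_less)
    also have "(\<Sum>i\<in>I. P (u @ [i])) = P u"
      using assms(2) by (simp add: P_def flip: sum_distrib_left)
    also have "(\<Sum>i\<in>I. m (u @ [i])) = emeasure M (\<Union>i\<in>I. {v \<in> T. prefix (u @ [i]) v})"
      unfolding m_def
      by (rule sum_emeasure) (auto simp: sets_M \<open>finite I\<close> disjoint_family_on_def prefix_def)
    also have "(\<Union>i\<in>I. {v \<in> T. prefix (u @ [i]) v}) = {v \<in> T. prefix u v}"
    proof (intro set_eqI iffI)
      fix v assume v: "v \<in> {v \<in> T. prefix u v}"
      have "u \<notin> T"
        using P_le_m[of u] that by auto
      with v obtain i r where "v = u @ i # r"
        by (auto simp: prefix_def neq_Nil_conv) (metis append_Nil2 list.exhaust)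
      moreover from this have "i \<in> I"
        using v \<open>T \<subseteq> lists I\<close> by auto
      ultimately show "v \<in> (\<Union>i\<in>I. {v \<in> T. prefix (u @ [i]) v})"
        using v by (auto simp: prefix_def)
    qed (auto simp: prefix_def)
    finally show False
      using that by (simp add: m_def)
  qed
  have "\<exists>F. \<forall>n. (m (F n) < P (F n) \<and> length (F n) = n) \<and> (\<exists>i\<in>I. F (Suc n) = F n @ [i])"
    by (rule dependent_nat_choice) (use start step in \<open>fastforce+\<close>)
  then obtain F where F: "\<And>n. m (F n) < P (F n)" "\<And>n. length (F n) = n"
      "\<And>n. \<exists>i\<in>I. F (Suc n) = F n @ [i]"
    by blast
  from F(3) obtain w where w: "\<And>n. w n \<in> I" "\<And>n. F (Suc n) = F n @ [w n]"
    by metis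
  have "F n = map w [0..<n]" for n
    by (induction n) (use F(2)[of 0] w(2) in auto)
  \<comment> \<open>No prefix of this infinite word can be in \<open>T\<close>, yet \<open>T\<close>
    meets every infinite path.\<close>
  with bar[of w] w(1) obtain n where "F n \<in> T" by auto
  then show False
    using P_le_m F(1) by (metis not_less)
qed

text \<open>A mass distribution argument: the mass of a covering set is estimated by the mass of the
  words at which \<open>R\<close> first drops below its diameter, and by volume only boundedly many of these
  words meet the set.\<close>

lemma hausdorff_dim_ge_tree:
  fixes p :: "'i \<Rightarrow> real" and R :: "'i list \<Rightarrow> real"
    and Y :: "'i list \<Rightarrow> 'a::euclidean_space set" and x :: "(nat \<Rightarrow> 'i) \<Rightarrow> 'a"
  assumes "finite I" "sum p I = 1" and p_nonneg: "\<And>i. i \<in> I \<Longrightarrow> 0 \<le> p i"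
    and "0 < t" "0 < \<kappa>" "0 < c" "0 \<le> C"
    and R_Nil: "R [] = 1"
    and R_step: "\<And>u i. u \<in> lists I \<Longrightarrow> i \<in> I \<Longrightarrow> \<kappa> * R u \<le> R (u @ [i])"
    and R_lim: "\<And>w. (\<And>n. w n \<in> I) \<Longrightarrow> (\<lambda>n. R (map w [0..<n])) \<longlonglongrightarrow> 0"
    and p_le: "\<And>u. u \<in> lists I \<Longrightarrow> prod_list (map p u) \<le> R u powr t"
    and diam: "\<And>u a b. u \<in> lists I \<Longrightarrow> u \<noteq> [] \<Longrightarrow> a \<in> Y u \<Longrightarrow> b \<in> Y u \<Longrightarrow> dist a b \<le> C * R u"
    and balls: "\<And>u. u \<in> lists I \<Longrightarrow> u \<noteq> [] \<Longrightarrow> ball (z u) (c * R u) \<subseteq> Y u"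
    and disj: "\<And>u v. u \<in> lists I \<Longrightarrow> v \<in> lists I \<Longrightarrow> \<not> prefix u v \<Longrightarrow> \<not> prefix v u \<Longrightarrow>
        ball (z u) (c * R u) \<inter> ball (z v) (c * R v) = {}"
    and code: "\<And>w n. (\<And>n. w n \<in> I) \<Longrightarrow> 0 < n \<Longrightarrow> x w \<in> Y (map w [0..<n])"
  shows "ereal t \<le> hausdorff_dim (x ` {w. \<forall>n. w n \<in> I})"
proof -
  define J where "J = x ` {w. \<forall>n. w n \<in> I}"
  \<comment> \<open>For \<open>d < 1\<close> these words are pairwise incomparable, and
    \<open>R u\<close> lies between \<open>\<kappa> * d\<close> and \<open>d\<close>, since the
    parent still exceeds \<open>d\<close>.\<close>
  define cut where "cut U d = {u \<in> lists I. R u \<le> d \<and> (\<forall>k<length u. d < R (take k u)) \<and> Y u \<inter> U \<noteq> {}}"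
    for U d
  define P where "P u = prod_list (map (\<lambda>i. ennreal (p i)) u)" for u
  define M where "M = point_measure UNIV P"
  \<comment> \<open>The disjoint balls of the cut words have radius at least
    \<open>c * \<kappa> * d\<close> and lie in a ball of radius \<open>(2 + C) * d\<close> about any
    point of \<open>U\<close>.\<close>
  define N where "N = ((2 + C) / (c * \<kappa>)) ^ DIM('a)"
  have "N > 0"
    using \<open>0 \<le> C\<close> \<open>0 < c\<close> \<open>0 < \<kappa>\<close> by (simp add: N_def)
  have P_eq: "P u = ennreal (prod_list (map p u)) \<and> 0 \<le> prod_list (map p u)" if "u \<in> lists I" for u
    using that unfolding P_def by (induction u) (auto simp: p_nonneg ennreal_mult)
  have cut_card: "finite (cut U d) \<and> card (cut U d) \<le> N"
    if "bounded U" "diameter U \<le> d" "0 < d" "d < 1" for U d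
  proof -
    have bound: "real (card B) \<le> N" if "finite B" "B \<subseteq> cut U d" for B
    proof (cases "U = {}")
      case True
      then have "B = {}" using that by (auto simp: cut_def)
      then show ?thesis using \<open>N > 0\<close> by simp
    next
      case False
      then obtain a where "a \<in> U" by blast
      have B: "u \<in> lists I" "u \<noteq> []" "R u \<le> d" "\<kappa> * d \<le> R u" "\<exists>b. b \<in> Y u \<and> b \<in> U" if "u \<in> B" for u
      proof -
        have u: "u \<in> cut U d" using that \<open>B \<subseteq> cut U d\<close> by blast
        then show "u \<in> lists I" "R u \<le> d" "\<exists>b. b \<in> Y u \<and> b \<in> U" by (auto simp: cut_def)
        show "u \<noteq> []" using u R_Nil \<open>d < 1\<close> by (auto simp: cut_def)
        then obtain v i where ui: "u = v @ [i]" by (metis rev_exhaust)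
        then have "d < R v" using u by (auto simp: cut_def dest!: spec[of _ "length v"])
        then have "\<kappa> * d \<le> \<kappa> * R v" using \<open>0 < \<kappa>\<close> by simp
        also have "\<dots> \<le> R u" using R_step[of v i] u ui by (auto simp: cut_def)
        finally show "\<kappa> * d \<le> R u" .
      qed
      have sub: "ball (z u) (c * \<kappa> * d) \<subseteq> ball (z u) (c * R u)" if "u \<in> B" for u
        using B(4)[OF that] \<open>0 < c\<close> by (intro subset_ball) (simp add: mult.assoc)
      have "(\<Sum>u\<in>B. (c * \<kappa> * d) ^ DIM('a)) \<le> ((2 + C) * d) ^ DIM('a)"
      proof (rule sum_disjoint_balls_le[of B z _ a])
        show "disjoint_family_on (\<lambda>u. ball (z u) (c * \<kappa> * d)) B"
          unfolding disjoint_family_on_def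
        proof (intro ballI impI)
          fix u v assume uv: "u \<in> B" "v \<in> B" "u \<noteq> v"
          have "\<not> prefix u v" if "u \<in> B" "v \<in> B" "u \<noteq> v" for u v
          proof
            assume "prefix u v"
            then obtain r where r: "v = u @ r" by (auto simp: prefix_def)
            with \<open>u \<noteq> v\<close> have "length u < length v" by auto
            moreover have "v \<in> cut U d" using that \<open>B \<subseteq> cut U d\<close> by blast
            ultimately have "d < R (take (length u) v)" by (simp add: cut_def)
            then show False using B(3)[OF \<open>u \<in> B\<close>] r by simp
          qed
          with uv have "ball (z u) (c * R u) \<inter> ball (z v) (c * R v) = {}"
            by (intro disj B) auto
          then show "ball (z u) (c * \<kappa> * d) \<inter> ball (z v) (c * \<kappa> * d) = {}"
            using sub uv by blast
        qed
        show "ball (z u) (c * \<kappa> * d) \<subseteq> ball a ((2 + C) * d)" if "u \<in> B" for u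
        proof
          fix y assume "y \<in> ball (z u) (c * \<kappa> * d)"
          then have y: "y \<in> Y u" using sub balls B that by blast
          obtain b where b: "b \<in> Y u" "b \<in> U" using B(5)[OF \<open>u \<in> B\<close>] by blast
          have "dist a b \<le> d"
            using diameter_bounded_bound[OF \<open>bounded U\<close> \<open>a \<in> U\<close> b(2)] \<open>diameter U \<le> d\<close> by simp
          moreover have "dist b y \<le> C * R u" using diam[OF B(1,2) b(1) y] that by simp
          moreover have "C * R u \<le> C * d" using B(3)[OF that] \<open>0 \<le> C\<close> by (intro mult_left_mono)
          ultimately have "dist a y \<le> d + C * d"
            using dist_triangle[of a y b] by linarith
          also have "\<dots> < (2 + C) * d" using \<open>0 < d\<close> by (simp add: algebra_simps)
          finally show "y \<in> ball a ((2 + C) * d)" by simp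
        qed
      qed (use \<open>finite B\<close> \<open>0 < c\<close> \<open>0 < \<kappa>\<close> \<open>0 < d\<close> \<open>0 \<le> C\<close> in auto)
      then have "real (card B) * (c * \<kappa>) ^ DIM('a) * d ^ DIM('a) \<le> (2 + C) ^ DIM('a) * d ^ DIM('a)"
        by (simp add: power_mult_distrib mult.assoc)
      then have "real (card B) * (c * \<kappa>) ^ DIM('a) \<le> (2 + C) ^ DIM('a)"
        using \<open>0 < d\<close> by simp
      then show ?thesis
        using \<open>0 < c\<close> \<open>0 < \<kappa>\<close> unfolding N_def by (simp add: power_divide field_simps)
    qed
    have "finite (cut U d) \<and> card (cut U d) \<le> nat \<lfloor>N\<rfloor>"
      using bound by (intro finite_if_finite_subsets_card_bdd) (auto simp: le_nat_floor)
    with bound[of "cut U d"] show ?thesis by auto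
  qed
  have cut_mass: "emeasure M (cut U d) \<le> ennreal N * ennreal (d powr t)"
    if "bounded U" "diameter U \<le> d" "0 < d" "d < 1" for U d
  proof -
    have fin: "finite (cut U d)" and card: "card (cut U d) \<le> N"
      using cut_card[OF that] by auto
    have "P u \<le> ennreal (d powr t)" if "u \<in> cut U d" for u
    proof -
      have u: "u \<in> lists I" "R u \<le> d" using that by (auto simp: cut_def)
      have "0 \<le> R u"
      proof (cases "u = []")
        case False
        then obtain v i where ui: "u = v @ [i]" by (metis rev_exhaust)
        then have "d < R v" using that by (auto simp: cut_def dest!: spec[of _ "length v"])
        then have "0 \<le> \<kappa> * R v" using \<open>0 < \<kappa>\<close> \<open>0 < d\<close> by simp
        also have "\<dots> \<le> R u" using R_step[of v i] u ui by auto
        finally show ?thesis .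
      qed (simp add: R_Nil)
      then have "R u powr t \<le> d powr t"
        using u(2) \<open>0 < t\<close> by (intro powr_mono2) auto
      then show ?thesis
        using p_le[OF u(1)] P_eq[OF u(1)] by (auto intro!: ennreal_leI)
    qed
    then have "emeasure M (cut U d) \<le> (\<Sum>u\<in>cut U d. ennreal (d powr t))"
      using fin by (simp only: M_def emeasure_point_measure_finite2 subset_UNIV) (rule sum_mono)
    also have "\<dots> = ennreal (card (cut U d)) * ennreal (d powr t)"
      by (simp add: ennreal_of_nat_eq_real_of_nat)
    also have "\<dots> \<le> ennreal N * ennreal (d powr t)"
      using card by (intro mult_right_mono ennreal_leI) auto
    finally show ?thesis .
  qed
  have cover: "1 \<le> ennreal N * ((\<Sum>k. diam_pow t (U k)) + ennreal e)"
    if J_cover: "J \<subseteq> (\<Union>k. U k)" and U: "\<And>k. bounded (U k)" "\<And>k. diameter (U k) \<le> 1 / 2" and "0 < e"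
    for U :: "nat \<Rightarrow> 'a set" and e
  proof -
    \<comment> \<open>A set of diameter 0 offers no positive scale; it gets one so small that the
      \<open>t\<close>-th powers of these scales add up to at most \<open>e\<close>. All scales are
      below \<open>R [] = 1\<close>, which keeps the empty word out of the cuts.\<close>
    define d where "d k = (if 0 < diameter (U k) then diameter (U k)
        else min (1 / 2) ((e * (1 / 2) ^ Suc k) powr (1 / t)))" for k
    have d: "0 < d k" "d k < 1" "diameter (U k) \<le> d k" for k
      using U(2)[of k] \<open>0 < e\<close> by (auto simp: d_def not_less intro: order.trans)
    have d_pow: "ennreal (d k powr t) \<le> diam_pow t (U k) + ennreal (e * (1 / 2) ^ Suc k)" for k
    proof (cases "0 < diameter (U k)")
      case True
      then have "U k \<noteq> {}" by auto
      then show ?thesis using True \<open>0 < t\<close> by (simp add: d_def diam_pow_def)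
    next
      case False
      then have "d k powr t \<le> ((e * (1 / 2) ^ Suc k) powr (1 / t)) powr t"
        using d(1)[of k] \<open>0 < t\<close> by (intro powr_mono2) (auto simp: d_def)
      also have "\<dots> = e * (1 / 2) ^ Suc k"
        using \<open>0 < t\<close> \<open>0 < e\<close> by (simp add: powr_powr)
      finally show ?thesis
        by (intro add_increasing ennreal_leI) auto
    qed
    have "1 \<le> emeasure M (\<Union>k. cut (U k) (d k))"
      unfolding M_def P_def[abs_def]
    proof (rule bar_mass_ge_1[OF \<open>finite I\<close>])
      show "(\<Sum>i\<in>I. ennreal (p i)) = 1"
        using p_nonneg \<open>sum p I = 1\<close> by (simp add: sum_ennreal)
      show "(\<Union>k. cut (U k) (d k)) \<subseteq> lists I" by (auto simp: cut_def)
      fix w :: "nat \<Rightarrow> 'i" assume w: "\<And>n. w n \<in> I"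
      then have "x w \<in> J" by (auto simp: J_def)
      then obtain k where k: "x w \<in> U k" using J_cover by blast
      have "eventually (\<lambda>n. R (map w [0..<n]) < d k) sequentially"
        using R_lim[OF w] d(1)[of k] by (rule order_tendstoD)
      then have "\<exists>n. R (map w [0..<n]) \<le> d k"
        by (meson eventually_sequentially less_imp_le order_refl)
      then obtain n where n: "R (map w [0..<n]) \<le> d k" "\<And>j. j < n \<Longrightarrow> d k < R (map w [0..<j])"
        using exists_least_iff[of "\<lambda>n. R (map w [0..<n]) \<le> d k"] by (auto simp: not_le)
      have "0 < n" using n(1) R_Nil d(2)[of k] by (intro gr0I) auto
      then have "x w \<in> Y (map w [0..<n])" using code w by blast
      with n k w have "map w [0..<n] \<in> cut (U k) (d k)"
        by (auto simp: cut_def take_map)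
      then show "\<exists>n. map w [0..<n] \<in> (\<Union>k. cut (U k) (d k))" by blast
    qed
    also have "\<dots> \<le> (\<Sum>k. emeasure M (cut (U k) (d k)))"
      by (rule emeasure_subadditive_countably) (simp add: M_def sets_point_measure)
    also have "\<dots> \<le> (\<Sum>k. ennreal N * (diam_pow t (U k) + ennreal (e * (1 / 2) ^ Suc k)))"
      by (intro suminf_le summableI order.trans[OF cut_mass mult_left_mono] d U d_pow) auto
    also have "\<dots> = ennreal N * ((\<Sum>k. diam_pow t (U k)) + (\<Sum>k. ennreal (e * (1 / 2) ^ Suc k)))"
      by (simp add: ennreal_suminf_cmult suminf_add summableI)
    also have "(\<Sum>k. ennreal (e * (1 / 2) ^ Suc k)) = ennreal e"
      using \<open>0 < e\<close> sums_mult[OF power_half_series, of e] by (intro suminf_ennreal_eq) auto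
    finally show ?thesis .
  qed
  have "t \<le> s" if "0 \<le> s" "hausdorff_measure s J = 0" for s
  proof (rule ccontr)
    assume "\<not> t \<le> s"
    have "hausdorff_premeasure s (1 / 2) J \<le> hausdorff_measure s J"
      unfolding hausdorff_measure_def by (rule SUP_upper) simp
    \<comment> \<open>Together with \<open>e = 1 / (4 * N)\<close> in \<open>cover\<close> this
      makes the total 3/4, which is less than 1.\<close>
    also have "\<dots> < ennreal (1 / (2 * N))"
      using that \<open>N > 0\<close> by simp
    finally obtain U :: "nat \<Rightarrow> 'a set" where U: "J \<subseteq> (\<Union>k. U k)" "\<And>k. bounded (U k)" "\<And>k. diameter (U k) \<le> 1 / 2"
      and lt: "(\<Sum>k. diam_pow s (U k)) < ennreal (1 / (2 * N))"
      unfolding hausdorff_premeasure_def Inf_less_iff by blast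
    have "(\<Sum>k. diam_pow t (U k)) \<le> (\<Sum>k. diam_pow s (U k))"
      using \<open>\<not> t \<le> s\<close> \<open>0 \<le> s\<close>
      by (intro suminf_le summableI diam_pow_antimono U(2) order.trans[OF U(3)]) auto
    with lt have lt': "(\<Sum>k. diam_pow t (U k)) \<le> ennreal (1 / (2 * N))" by simp
    have "1 \<le> ennreal N * ((\<Sum>k. diam_pow t (U k)) + ennreal (1 / (4 * N)))"
      using \<open>N > 0\<close> by (intro cover U) auto
    also have "\<dots> \<le> ennreal N * (ennreal (1 / (2 * N)) + ennreal (1 / (4 * N)))"
      by (intro mult_left_mono add_right_mono lt') auto
    also have "\<dots> = ennreal (3 / 4)"
      using \<open>N > 0\<close> by (simp add: divide_simps flip: ennreal_plus ennreal_mult)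
    finally show False by simp
  qed
  then show ?thesis
    unfolding hausdorff_dim_def J_def by (intro Inf_greatest) auto
qed

section \<open>Words of a graph directed Markov system\<close>

lemma onorm_eqI_similarity:
  fixes L :: "'a::euclidean_space \<Rightarrow> 'b::real_normed_vector"
  assumes "bounded_linear L" "\<And>h. norm (L h) = c * norm h"
  shows "onorm L = c"
proof (rule antisym)
  show "onorm L \<le> c"
    using assms(2) by (intro onorm_le) simp
  obtain b :: 'a where "b \<in> Basis"
    using nonempty_Basis by blast
  then show "c \<le> onorm L"
    using onorm[OF assms(1), of b] assms(2)[of b] by simp
qed

lemma word_map_Nil [simp]: "word_map f [] x = x"
  by (simp add: word_map_def)

lemma word_map_Cons [simp]: "word_map f (a # w) x = f a (word_map f w x)"
  by (simp add: word_map_def)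

lemma word_map_append [simp]: "word_map f (u @ v) x = word_map f u (word_map f v x)"
  by (induction u) simp_all

lemma words_Nil [simp]: "[] \<in> words G"
  by (simp add: words_def)

lemma words_Cons:
  "a # w \<in> words G \<longleftrightarrow> a \<in> edges G \<and> w \<in> words G \<and> (w = [] \<or> inc G a (hd w))"
  by (auto simp: words_def successively_Cons)

lemma words_append:
  "u @ v \<in> words G \<longleftrightarrow>
     u \<in> words G \<and> v \<in> words G \<and> (u = [] \<or> v = [] \<or> inc G (last u) (hd v))"
  by (auto simp: words_def successively_append_iff)

lemma prefix_in_words: "w \<in> infinite_words G \<Longrightarrow> map w [0..<n] \<in> words G"
proof (induction n)
  case (Suc n)
  then show ?case
    by (cases n) (auto simp: words_append words_Cons infinite_words_def)
qed simp

text \<open>The condition at position \<open>k\<close> is visible in every prefix of length at least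
  \<open>k + 2\<close>, so admissible prefixes of unbounded length suffice. Block concatenations
  supply them at multiples of the block length.\<close>

lemma infinite_wordsI:
  assumes "\<And>n. \<exists>m\<ge>n. map w [0..<m] \<in> words G"
  shows "w \<in> infinite_words G"
  unfolding infinite_words_def
proof (intro CollectI allI)
  fix k
  obtain m where "Suc (Suc k) \<le> m" and m: "map w [0..<m] \<in> words G"
    using assms by blast
  then obtain j where "m = k + Suc (Suc j)"
    by (metis add_Suc_right add_Suc less_eqE)
  then have "map w [0..<m] = map w [0..<k] @ w k # w (Suc k) # map w [Suc (Suc k)..<m]"
    by (simp only: upt_add_eq_append[OF le0]) (simp add: upt_conv_Cons del: upt_Suc)
  with m show "w k \<in> edges G \<and> inc G (w k) (w (Suc k))"
    by (simp add: words_append words_Cons)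
qed

text \<open>\<open>coding\<close> never consults the alphabet, so the subsystem has the same coding
  map on fewer words. Later statements can therefore speak of words of \<open>G\<close> with letters
  in \<open>F\<close>.\<close>

lemma limit_set_subsystem:
  assumes "F \<subseteq> edges G"
  shows "limit_set (subsystem G F) = coding G ` {w \<in> infinite_words G. range w \<subseteq> F}"
proof -
  have "infinite_words (subsystem G F) = {w \<in> infinite_words G. range w \<subseteq> F}"
    using assms by (auto simp: infinite_words_def subsystem_def)
  moreover have "coding (subsystem G F) = coding G"
    by (auto simp: coding_def subsystem_def fun_eq_iff)
  ultimately show ?thesis
    by (simp add: limit_set_def)
qed

text \<open>The infinite concatenation of the blocks \<open>w 0\<close>, \<open>w 1\<close>, ...; a
  common block length \<open>N\<close> locates each letter by division with remainder.\<close>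

definition concat_word :: "nat \<Rightarrow> (nat \<Rightarrow> 'e list) \<Rightarrow> nat \<Rightarrow> 'e" where
  "concat_word N w k = w (k div N) ! (k mod N)"

lemma map_concat_word:
  assumes "\<And>n. length (w n) = N"
  shows "map (concat_word N w) [0..<n * N] = concat (map w [0..<n])"
proof (induction n)
  case (Suc n)
  have "map (concat_word N w) [n * N..<n * N + N] = w n"
    by (rule nth_equalityI) (use assms in \<open>auto simp: concat_word_def\<close>)
  moreover have "[0..<Suc n * N] = [0..<n * N] @ [n * N..<n * N + N]"
    by (metis add.commute le0 mult_Suc upt_add_eq_append)
  ultimately show ?case
    using Suc by simp
qed simp

text \<open>Blocks of one positive length can be cut off unambiguously. This transfers
  incomparability from words over blocks to words over letters, where the open set condition
  applies.\<close>

lemma prefix_concatD: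
  assumes "0 < N" "\<And>x. x \<in> set u \<Longrightarrow> length x = N" "\<And>x. x \<in> set v \<Longrightarrow> length x = N"
    and "prefix (concat u) (concat v)"
  shows "prefix u v"
  using assms(2-)
proof (induction u arbitrary: v)
  case (Cons x u)
  then obtain y v' where v: "v = y # v'" using \<open>0 < N\<close> by (cases v) auto
  obtain r where "x @ concat u @ r = y @ concat v'"
    using Cons.prems(3) v by (auto simp: prefix_def)
  moreover have "length x = length y" using Cons.prems v by simp
  ultimately have "x = y" "concat u @ r = concat v'" by auto
  then show ?case using Cons.IH[of v'] Cons.prems v by auto
qed simp

section \<open>Geometry of conformal systems\<close>

text \<open>Fixes the witnesses of the existential assumptions once for all constants below. The
  lower distortion bound is \<open>distortion\<close> with \<open>p\<close> and \<open>q\<close>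
  exchanged.\<close>

locale conformal_system =
  fixes G :: "('v, 'e, real ^ 'n) gdms"
    and W :: "'v \<Rightarrow> (real ^ 'n) set" and f :: "'e \<Rightarrow> real ^ 'n \<Rightarrow> real ^ 'n"
    and S :: "'v \<Rightarrow> (real ^ 'n) set" and K s :: real
  assumes gdms: "is_gdms G"
    and s: "0 < s" "s < 1"
    and lipschitz: "e \<in> edges G \<Longrightarrow> s-lipschitz_on (sp G (tm G e)) (phi G e)"
    and conn: "v \<in> verts G \<Longrightarrow> connected (sp G v)"
    and regular: "v \<in> verts G \<Longrightarrow> closure (interior (sp G v)) = sp G v"
    and open_set_condition: "a \<in> edges G \<Longrightarrow> b \<in> edges G \<Longrightarrow> a \<noteq> b \<Longrightarrow>
      phi G a ` interior (sp G (tm G a)) \<inter> phi G b ` interior (sp G (tm G b)) = {}"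
    and ext: "conformal_extension G W f"
    and nbhd: "v \<in> verts G \<Longrightarrow> sp G v \<subseteq> interior (S v)" "v \<in> verts G \<Longrightarrow> S v \<subseteq> W v"
    and K: "1 \<le> K"
    and distortion: "w \<in> words G \<Longrightarrow> w \<noteq> [] \<Longrightarrow> p \<in> S (tm G (last w)) \<Longrightarrow> q \<in> S (tm G (last w)) \<Longrightarrow>
      deriv_norm f w p / deriv_norm f w q \<le> K"
begin

text \<open>The domain of \<open>word_map f w\<close>. As \<open>last []\<close> is unspecified, it
  is meaningful for nonempty words only; hence the recurring assumption
  \<open>w \<noteq> []\<close>.\<close>

definition X :: "'e list \<Rightarrow> (real ^ 'n) set" where
  "X w = sp G (tm G (last w))"

lemma finite_verts: "finite (verts G)"
  and countable_edges: "countable (edges G)"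
  using gdms by (simp_all add: is_gdms_def)

lemma edges_verts: "e \<in> edges G \<Longrightarrow> tm G e \<in> verts G" "e \<in> edges G \<Longrightarrow> im G e \<in> verts G"
  and inc_vert: "a \<in> edges G \<Longrightarrow> b \<in> edges G \<Longrightarrow> inc G a b \<Longrightarrow> tm G a = im G b"
  using gdms by (simp_all add: is_gdms_def)

lemma sp_nonempty: "v \<in> verts G \<Longrightarrow> sp G v \<noteq> {}"
  and sp_compact: "v \<in> verts G \<Longrightarrow> compact (sp G v)"
  and phi_sp: "e \<in> edges G \<Longrightarrow> phi G e ` sp G (tm G e) \<subseteq> sp G (im G e)"
  using gdms by (simp_all add: is_gdms_def)

lemma ex_tm:
  assumes "v \<in> verts G"
  obtains e where "e \<in> edges G" "tm G e = v"
proof -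
  have "\<forall>v\<in>verts G. \<exists>e\<in>edges G. \<exists>e'\<in>edges G. tm G e = v \<and> im G e' = v"
    using gdms by (simp add: is_gdms_def)
  with assms show thesis using that by blast
qed

lemma sp_S: "v \<in> verts G \<Longrightarrow> sp G v \<subseteq> S v"
  using nbhd(1) interior_subset by blast

lemma word_verts:
  assumes "w \<in> words G" "w \<noteq> []"
  shows "last w \<in> edges G" "tm G (last w) \<in> verts G" "hd w \<in> edges G" "im G (hd w) \<in> verts G"
proof -
  show "last w \<in> edges G" "hd w \<in> edges G"
    using assms by (auto simp: words_def)
  then show "tm G (last w) \<in> verts G" "im G (hd w) \<in> verts G"
    by (simp_all add: edges_verts)
qed

lemma f_eq_phi: "e \<in> edges G \<Longrightarrow> x \<in> sp G (tm G e) \<Longrightarrow> f e x = phi G e x"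
  using ext by (simp add: conformal_extension_def)

lemma f_diffeo: "e \<in> edges G \<Longrightarrow> conformal_diffeo_into (W (tm G e)) (W (im G e)) (f e)"
  using ext by (simp add: conformal_extension_def)

lemma f_into: "e \<in> edges G \<Longrightarrow> x \<in> W (tm G e) \<Longrightarrow> f e x \<in> W (im G e)"
  using f_diffeo unfolding conformal_diffeo_into_def by blast

lemma f_inj: "e \<in> edges G \<Longrightarrow> inj_on (f e) (W (tm G e))"
proof -
  assume "e \<in> edges G"
  from f_diffeo[OF this] obtain g where "\<forall>x\<in>W (tm G e). g (f e x) = x"
    unfolding conformal_diffeo_into_def by auto
  then show ?thesis by (intro inj_on_inverseI[of _ g]) simp
qed

section \<open>Derivatives of word maps\<close>

lemma f_has_derivative_similarity:
  assumes "e \<in> edges G" "x \<in> W (tm G e)"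
  shows "\<exists>L c. (f e has_derivative L) (at x) \<and> 0 < c \<and> (\<forall>h. norm (L h) = c * norm h)"
proof -
  have *: "C1_on (W (tm G e)) (f e)" "similarity_map (frechet_derivative (f e) (at x))"
    using f_diffeo[OF assms(1)] assms(2) unfolding conformal_diffeo_into_def by auto
  then have "f e differentiable at x"
    using assms(2) unfolding C1_on_def differentiable_def by blast
  then have "(f e has_derivative frechet_derivative (f e) (at x)) (at x)"
    using frechet_derivative_works by blast
  with *(2) show ?thesis
    unfolding similarity_map_def by blast
qed

lemma Cons_vert: "a # w \<in> words G \<Longrightarrow> w \<noteq> [] \<Longrightarrow> tm G a = im G (hd w)"
  using word_verts(3)[of w] by (simp add: words_Cons inc_vert)

lemma append_vert:
  "u @ v \<in> words G \<Longrightarrow> u \<noteq> [] \<Longrightarrow> v \<noteq> [] \<Longrightarrow> tm G (last u) = im G (hd v)"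
  using word_verts(1)[of u] word_verts(3)[of v] by (simp add: words_append inc_vert)

lemma word_into:
  assumes "w \<in> words G" "w \<noteq> []" "x \<in> W (tm G (last w))"
  shows "word_map f w x \<in> W (im G (hd w))"
  using assms
proof (induction w)
  case (Cons a w)
  then show ?case
    using Cons_vert[of a w] by (cases "w = []") (auto simp: words_Cons f_into)
qed simp

lemma word_inj:
  assumes "w \<in> words G" "w \<noteq> []"
  shows "inj_on (word_map f w) (W (tm G (last w)))"
  using assms
proof (induction w)
  case (Cons a w)
  show ?case
  proof (cases "w = []")
    case True
    then show ?thesis using Cons.prems f_inj[of a] by (simp add: words_Cons inj_on_def)
  next
    case False
    then have w: "w \<in> words G" "a \<in> edges G" using Cons.prems by (auto simp: words_Cons)
    have "word_map f w x \<in> W (tm G a)" if "x \<in> W (tm G (last w))" for x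
      using word_into[OF w(1) False that] Cons_vert[OF Cons.prems(1) False] by simp
    then show ?thesis
      using Cons.IH[OF w(1) False] f_inj[OF w(2)] False by (simp add: inj_on_def)
  qed
qed simp

lemma word_has_derivative_similarity:
  assumes "w \<in> words G" "w \<noteq> []" "x \<in> W (tm G (last w))"
  shows "\<exists>L c. (word_map f w has_derivative L) (at x) \<and> 0 < c \<and> (\<forall>h. norm (L h) = c * norm h)"
  using assms
proof (induction w)
  case (Cons a w)
  have eq: "word_map f (a # w) = (\<lambda>x. f a (word_map f w x))" by auto
  show ?case
  proof (cases "w = []")
    case True
    then show ?thesis
      using Cons.prems f_has_derivative_similarity[of a x] unfolding eq by (simp add: words_Cons)
  next
    case False
    then have w: "w \<in> words G" "a \<in> edges G" "x \<in> W (tm G (last w))"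
      using Cons.prems by (auto simp: words_Cons)
    have "word_map f w x \<in> W (tm G a)"
      using word_into[OF w(1) False w(3)] Cons_vert[OF Cons.prems(1) False] by simp
    from f_has_derivative_similarity[OF w(2) this] obtain L c
      where L: "(f a has_derivative L) (at (word_map f w x))" "0 < c" "\<And>h. norm (L h) = c * norm h"
      by blast
    obtain L' c' where L': "(word_map f w has_derivative L') (at x)" "0 < c'" "\<And>h. norm (L' h) = c' * norm h"
      using Cons.IH[OF w(1) False w(3)] by blast
    have "((\<lambda>x. f a (word_map f w x)) has_derivative (\<lambda>h. L (L' h))) (at x)"
      using has_derivative_compose[OF L'(1) L(1)] .
    moreover have "norm (L (L' h)) = (c * c') * norm h" for h
      using L L' by simp
    ultimately show ?thesis
      unfolding eq using L(2) L'(2) by (metis mult_pos_pos)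
  qed
qed simp

lemma deriv_norm_eqI:
  assumes "(word_map f w has_derivative L) (at x)" "\<And>h. norm (L h) = c * norm h"
  shows "deriv_norm f w x = c"
proof -
  have "frechet_derivative (word_map f w) (at x) = L"
    using assms(1) by (metis frechet_derivative_at)
  then show ?thesis
    unfolding deriv_norm_def
    using assms(2) has_derivative_bounded_linear[OF assms(1)] by (simp add: onorm_eqI_similarity)
qed

lemma word_derivative:
  assumes "w \<in> words G" "w \<noteq> []" "x \<in> W (tm G (last w))"
  shows "(word_map f w has_derivative frechet_derivative (word_map f w) (at x)) (at x)"
    and "norm (frechet_derivative (word_map f w) (at x) h) = deriv_norm f w x * norm h"
    and "0 < deriv_norm f w x"
proof -
  obtain L c where L: "(word_map f w has_derivative L) (at x)" "0 < c" "\<And>h. norm (L h) = c * norm h"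
    using word_has_derivative_similarity[OF assms] by blast
  have "frechet_derivative (word_map f w) (at x) = L"
    using frechet_derivative_at[OF L(1)] by simp
  with L deriv_norm_eqI[OF L(1,3)]
  show "(word_map f w has_derivative frechet_derivative (word_map f w) (at x)) (at x)"
    and "norm (frechet_derivative (word_map f w) (at x) h) = deriv_norm f w x * norm h"
    and "0 < deriv_norm f w x"
    by simp_all
qed

text \<open>Similarities scale all vectors alike, so operator norms multiply exactly; for general
  linear maps only one inequality holds.\<close>

lemma deriv_norm_append:
  assumes "u @ v \<in> words G" "u \<noteq> []" "v \<noteq> []" "x \<in> W (tm G (last v))"
  shows "deriv_norm f (u @ v) x = deriv_norm f u (word_map f v x) * deriv_norm f v x"
proof -
  have uv: "u \<in> words G" "v \<in> words G" "tm G (last u) = im G (hd v)"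
    using assms append_vert[OF assms(1)] by (simp_all add: words_append)
  have "word_map f v x \<in> W (tm G (last u))"
    using word_into[OF uv(2) assms(3,4)] uv(3) by simp
  note L = word_derivative[OF uv(1) assms(2) this]
  note L' = word_derivative[OF uv(2) assms(3,4)]
  have "word_map f (u @ v) = (\<lambda>x. word_map f u (word_map f v x))" by auto
  with has_derivative_compose[OF L'(1) L(1)]
  have "(word_map f (u @ v) has_derivative (\<lambda>h. frechet_derivative (word_map f u) (at (word_map f v x))
      (frechet_derivative (word_map f v) (at x) h))) (at x)" by simp
  then show ?thesis
    by (rule deriv_norm_eqI) (simp only: L(2) L'(2) mult.assoc)
qed

text \<open>The extension may be replaced by the given map only at points known to lie in the space,
  so the induction for the first claim uses the second.\<close>

lemma word_sp:
  assumes "w \<in> words G" "w \<noteq> []" "x \<in> X w"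
  shows "word_map f w x = word_map (phi G) w x" "word_map f w x \<in> sp G (im G (hd w))"
  using assms
proof (induction w)
  case (Cons a w)
  case 1
  then show ?case
    using Cons_vert[of a w] Cons.IH by (cases "w = []") (auto simp: words_Cons f_eq_phi X_def)
  case 2
  then show ?case
    using Cons_vert[of a w] Cons.IH(2) phi_sp[of a] f_eq_phi[of a]
    by (cases "w = []") (auto simp: words_Cons X_def)
qed simp_all

lemma word_contraction:
  assumes "w \<in> words G" "w \<noteq> []" "x \<in> X w" "y \<in> X w"
  shows "dist (word_map f w x) (word_map f w y) \<le> s ^ length w * dist x y"
  using assms
proof (induction w)
  case (Cons a w)
  have f_contr: "dist (f a x) (f a y) \<le> s * dist x y" if "x \<in> sp G (tm G a)" "y \<in> sp G (tm G a)" for x y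
    using that lipschitz_onD[OF lipschitz, of a x y] Cons.prems(1) by (simp add: words_Cons f_eq_phi)
  show ?case
  proof (cases "w = []")
    case True
    then show ?thesis using Cons.prems f_contr by (simp add: X_def)
  next
    case False
    then have w: "w \<in> words G" "x \<in> X w" "y \<in> X w"
      using Cons.prems by (auto simp: words_Cons X_def)
    have "dist (f a (word_map f w x)) (f a (word_map f w y)) \<le> s * dist (word_map f w x) (word_map f w y)"
      using word_sp(2)[OF w(1) False] w Cons_vert[OF Cons.prems(1) False] by (intro f_contr) auto
    also have "\<dots> \<le> s * (s ^ length w * dist x y)"
      using Cons.IH[OF w(1) False] w s by (intro mult_left_mono) auto
    finally show ?thesis by (simp add: mult.assoc)
  qed
qed simp

section \<open>Base points and the reference derivative\<close>

definition center :: "'v \<Rightarrow> real ^ 'n" where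
  "center v = (SOME x. x \<in> interior (sp G v))"

lemma center_interior:
  assumes "v \<in> verts G"
  shows "center v \<in> interior (sp G v)"
proof -
  have "interior (sp G v) \<noteq> {}"
    using regular[OF assms] sp_nonempty[OF assms] by auto
  then show ?thesis
    unfolding center_def by (rule some_in_eq[THEN iffD2])
qed

lemma center_sp: "v \<in> verts G \<Longrightarrow> center v \<in> sp G v"
  using center_interior[of v] interior_subset[of "sp G v"] by (rule subsetD[rotated])

lemma center_S: "v \<in> verts G \<Longrightarrow> center v \<in> S v"
  using center_sp sp_S by (rule subsetD[rotated])

text \<open>By bounded distortion the derivative norm at any point of
  \<open>S (tm G (last w))\<close> lies between \<open>D w / K\<close> and \<open>K * D w\<close>,
  so one number stands for the size of the whole image.\<close>

definition D :: "'e list \<Rightarrow> real" where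
  "D w = deriv_norm f w (center (tm G (last w)))"

context
  fixes w assumes w: "w \<in> words G" "w \<noteq> []"
begin

lemma deriv_norm_pos: "x \<in> W (tm G (last w)) \<Longrightarrow> 0 < deriv_norm f w x"
  by (rule word_derivative(3)[OF w])

lemma S_W: "S (tm G (last w)) \<subseteq> W (tm G (last w))"
  using nbhd(2) word_verts[OF w] by simp

lemma center_mem: "center (tm G (last w)) \<in> S (tm G (last w))"
  using center_S word_verts[OF w] by simp

lemma D_pos: "0 < D w"
  unfolding D_def by (rule deriv_norm_pos[OF subsetD[OF S_W center_mem]])

lemma deriv_norm_bounds:
  assumes "x \<in> S (tm G (last w))"
  shows "D w / K \<le> deriv_norm f w x" "deriv_norm f w x \<le> K * D w"
proof -
  have "0 < deriv_norm f w x" using assms S_W deriv_norm_pos by blast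
  then show "D w / K \<le> deriv_norm f w x" "deriv_norm f w x \<le> K * D w"
    using distortion[OF w assms center_mem] distortion[OF w center_mem assms] D_pos K
    unfolding D_def[symmetric] by (simp_all add: field_simps)
qed

text \<open>The lower derivative bound turns into an inner radius. The centre \<open>y\<close> is
  arbitrary because the hole used for porosity need not lie at the base point.\<close>

lemma ball_subset_word_image:
  assumes "ball y r \<subseteq> S (tm G (last w))" "0 < r"
  shows "ball (word_map f w y) (D w / K * r) \<subseteq> word_map f w ` ball y r"
proof -
  have sub: "ball y r \<subseteq> W (tm G (last w))" using assms S_W by blast
  have L: "(word_map f w has_derivative frechet_derivative (word_map f w) (at x)) (at x)"
    "norm (frechet_derivative (word_map f w) (at x) h) = deriv_norm f w x * norm h"
    if "x \<in> ball y r" for x h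
    using word_derivative[OF w, of x] sub that by auto
  show ?thesis
  proof (rule ball_subset_image_of_expanding_derivative)
    show "D w / K * norm h \<le> norm (frechet_derivative (word_map f w) (at x) h)" if "x \<in> ball y r" for x h
      unfolding L(2)[OF that] using that assms by (intro mult_right_mono deriv_norm_bounds) auto
    show "inj_on (word_map f w) (ball y r)"
      using word_inj[OF w] sub by (rule inj_on_subset)
  qed (use L D_pos K assms in auto)
qed

lemma word_lipschitz_ball:
  assumes "convex B" "B \<subseteq> S (tm G (last w))" "x \<in> B" "y \<in> B"
  shows "dist (word_map f w x) (word_map f w y) \<le> K * D w * dist x y"
proof -
  have "norm (word_map f w x - word_map f w y) \<le> K * D w * norm (x - y)"
  proof (rule differentiable_bound[OF \<open>convex B\<close>])
    fix z assume "z \<in> B"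
    then have z: "z \<in> S (tm G (last w))" "z \<in> W (tm G (last w))" using assms(2) S_W by auto
    show "(word_map f w has_derivative frechet_derivative (word_map f w) (at z)) (at z within B)"
      using word_derivative(1)[OF w z(2)] by (rule has_derivative_at_withinI)
    show "onorm (frechet_derivative (word_map f w) (at z)) \<le> K * D w"
      using deriv_norm_bounds(2)[OF z(1)] by (simp add: deriv_norm_def)
  qed (use assms in auto)
  then show ?thesis by (simp add: dist_norm)
qed

end

text \<open>The chain rule is exact, but it takes the outer derivative at the image of the base
  point of \<open>v\<close>; moving it to the base point of \<open>u\<close> costs the factor
  \<open>K\<close>.\<close>

lemma D_append:
  assumes "u @ v \<in> words G" "u \<noteq> []" "v \<noteq> []"
  shows "D u * D v / K \<le> D (u @ v)"
proof -
  have uv: "u \<in> words G" "v \<in> words G" "tm G (last u) = im G (hd v)"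
    using assms append_vert[OF assms(1)] by (simp_all add: words_append)
  note v = word_verts[OF uv(2) assms(3)]
  let ?x = "center (tm G (last v))"
  have "?x \<in> X v"
    using center_sp[OF v(2)] by (simp add: X_def)
  then have "word_map f v ?x \<in> S (tm G (last u))"
    using word_sp(2)[OF uv(2) assms(3)] sp_S v uv(3) by auto
  then have "D u / K * D v \<le> deriv_norm f u (word_map f v ?x) * D v"
    using D_pos[OF uv(2) assms(3)] by (intro mult_right_mono deriv_norm_bounds uv assms) auto
  also have "\<dots> = D (u @ v)"
    unfolding D_def using center_mem[OF uv(2) assms(3)] S_W[OF uv(2) assms(3)] assms
    by (subst deriv_norm_append) auto
  finally show ?thesis by simp
qed

text \<open>Here finiteness of the set of connecting words enters: attaching one of them costs a
  factor that does not depend on the other word.\<close>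

lemma D_extension:
  assumes "finite \<Lambda>" "\<Lambda> \<subseteq> words G"
  obtains \<kappa> where "0 < \<kappa>" "\<And>u v. v \<in> \<Lambda> \<Longrightarrow> u @ v \<in> words G \<Longrightarrow> u \<noteq> [] \<Longrightarrow> \<kappa> * D u \<le> D (u @ v)"
    "\<And>u v. v \<in> \<Lambda> \<Longrightarrow> v @ u \<in> words G \<Longrightarrow> u \<noteq> [] \<Longrightarrow> \<kappa> * D u \<le> D (v @ u)"
proof -
  \<comment> \<open>The entry 1 handles the empty word and keeps the set nonempty.\<close>
  define \<kappa> where "\<kappa> = Min (insert 1 ((\<lambda>v. D v / K) ` (\<Lambda> - {[]})))"
  have fin: "finite (insert 1 ((\<lambda>v. D v / K) ` (\<Lambda> - {[]})))"
    by (intro finite.insertI finite_imageI finite_Diff assms(1))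
  have "0 < D v / K" if "v \<in> \<Lambda>" "v \<noteq> []" for v
    using D_pos[of v] that assms(2) K by (auto intro!: divide_pos_pos)
  then have "0 < \<kappa>"
    unfolding \<kappa>_def using fin by (subst Min_gr_iff) auto
  have le1: "\<kappa> \<le> 1" and le: "\<And>v. v \<in> \<Lambda> \<Longrightarrow> v \<noteq> [] \<Longrightarrow> \<kappa> \<le> D v / K"
    unfolding \<kappa>_def using fin by (auto intro!: Min_le)
  show ?thesis
  proof (rule that[OF \<open>0 < \<kappa>\<close>])
    fix u v assume *: "v \<in> \<Lambda>" "u @ v \<in> words G" "u \<noteq> []"
    then have "0 < D u" using D_pos by (auto simp: words_append)
    show "\<kappa> * D u \<le> D (u @ v)"
    proof (cases "v = []")
      case False
      have "\<kappa> * D u \<le> D v / K * D u"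
        using le[OF *(1) False] \<open>0 < D u\<close> by (intro mult_right_mono) auto
      then show ?thesis using D_append[OF *(2,3) False] by (simp add: mult.commute)
    qed (use le1 \<open>0 < D u\<close> in simp)
  next
    fix u v assume *: "v \<in> \<Lambda>" "v @ u \<in> words G" "u \<noteq> []"
    then have "0 < D u" using D_pos by (auto simp: words_append)
    show "\<kappa> * D u \<le> D (v @ u)"
    proof (cases "v = []")
      case False
      have "\<kappa> * D u \<le> D v / K * D u"
        using le[OF *(1) False] \<open>0 < D u\<close> by (intro mult_right_mono) auto
      then show ?thesis using D_append[OF *(2) False *(3)] by simp
    qed (use le1 \<open>0 < D u\<close> in simp)
  qed
qed

section \<open>Uniform size estimates\<close>

lemma interior_radius:
  obtains \<rho> where "0 < \<rho>" "\<And>v. v \<in> verts G \<Longrightarrow> ball (center v) \<rho> \<subseteq> interior (sp G v)"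
proof -
  have "\<exists>r>0. ball (center v) r \<subseteq> interior (sp G v)" if "v \<in> verts G" for v
    using center_interior[OF that] open_interior open_contains_ball by blast
  then obtain r where r: "\<And>v. v \<in> verts G \<Longrightarrow> 0 < r v"
      "\<And>v. v \<in> verts G \<Longrightarrow> ball (center v) (r v) \<subseteq> interior (sp G v)"
    by metis
  define \<rho> where "\<rho> = Min (insert 1 (r ` verts G))"
  have "0 < \<rho>"
    unfolding \<rho>_def using finite_verts r(1) by (subst Min_gr_iff) auto
  moreover have "ball (center v) \<rho> \<subseteq> interior (sp G v)" if "v \<in> verts G" for v
  proof -
    have "\<rho> \<le> r v" unfolding \<rho>_def using finite_verts that by (intro Min_le) auto
    with r(2)[OF that] show ?thesis by (meson order.trans subset_ball)
  qed
  ultimately show thesis using that by blast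
qed

lemma sp_bound:
  obtains M where "0 < M" "\<And>v x. v \<in> verts G \<Longrightarrow> x \<in> sp G v \<Longrightarrow> norm x < M"
proof -
  have "bounded (\<Union>v\<in>verts G. sp G v)"
    using finite_verts sp_compact by (auto intro: compact_imp_bounded)
  then obtain M where "0 < M" "\<forall>x\<in>(\<Union>v\<in>verts G. sp G v). norm x < M"
    unfolding bounded_pos_less by blast
  with that show thesis by blast
qed

text \<open>On a ball of fixed radius \<delta> about a point of \<open>sp G v\<close>, contained in
  \<open>S v\<close>, the mean value inequality applies; chains of such steps cross the connected
  but possibly non-convex space. Finitely many vertices make \<open>C\<close> uniform.\<close>

lemma word_diameter:
  obtains C where "0 < C" "\<And>w x y. w \<in> words G \<Longrightarrow> w \<noteq> [] \<Longrightarrow> x \<in> X w \<Longrightarrow> y \<in> X w \<Longrightarrow>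
    dist (word_map f w x) (word_map f w y) \<le> C * D w"
proof -
  have "\<exists>C. \<forall>w\<in>words G. w \<noteq> [] \<longrightarrow> tm G (last w) = v \<longrightarrow>
      (\<forall>x\<in>sp G v. \<forall>y\<in>sp G v. dist (word_map f w x) (word_map f w y) \<le> C * D w)"
    if v: "v \<in> verts G" for v
  proof -
    obtain \<delta> where "0 < \<delta>" and \<delta>: "(\<Union>x\<in>sp G v. ball x \<delta>) \<subseteq> interior (S v)"
      using compact_subset_open_imp_ball_epsilon_subset[OF sp_compact[OF v] open_interior nbhd(1)[OF v]]
      by blast
    obtain N where N: "0 \<le> N" "\<And>(h :: real ^ 'n \<Rightarrow> real ^ 'n) c p q.
        \<lbrakk>\<And>p q. p \<in> sp G v \<Longrightarrow> q \<in> sp G v \<Longrightarrow> dist p q < \<delta> \<Longrightarrow> dist (h p) (h q) \<le> c;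
         p \<in> sp G v; q \<in> sp G v\<rbrakk> \<Longrightarrow> dist (h p) (h q) \<le> N * c"
      using compact_connected_oscillation_bound[OF sp_compact[OF v] conn[OF v] \<open>0 < \<delta>\<close>] by metis
    have "dist (word_map f w x) (word_map f w y) \<le> (N * (K * \<delta>)) * D w"
      if w: "w \<in> words G" "w \<noteq> []" "tm G (last w) = v" "x \<in> sp G v" "y \<in> sp G v" for w x y
    proof -
      have "dist (word_map f w x) (word_map f w y) \<le> N * (K * D w * \<delta>)"
      proof (rule N(2)[OF _ w(4,5)])
        fix p q assume pq: "p \<in> sp G v" "q \<in> sp G v" "dist p q < \<delta>"
        have "ball p \<delta> \<subseteq> S (tm G (last w))"
          using \<delta> pq(1) interior_subset w(3) by blast
        then have "dist (word_map f w p) (word_map f w q) \<le> K * D w * dist p q"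
          using pq \<open>0 < \<delta>\<close> by (intro word_lipschitz_ball[OF w(1,2) convex_ball]) auto
        also have "\<dots> \<le> K * D w * \<delta>"
          using pq(3) K D_pos[OF w(1,2)] by (intro mult_left_mono) auto
        finally show "dist (word_map f w p) (word_map f w q) \<le> K * D w * \<delta>" .
      qed
      then show ?thesis by (simp add: mult_ac)
    qed
    then show ?thesis by blast
  qed
  then obtain C where C: "\<And>v w x y. v \<in> verts G \<Longrightarrow> w \<in> words G \<Longrightarrow> w \<noteq> [] \<Longrightarrow> tm G (last w) = v \<Longrightarrow>
      x \<in> sp G v \<Longrightarrow> y \<in> sp G v \<Longrightarrow> dist (word_map f w x) (word_map f w y) \<le> C v * D w"
    by metis
  define C' where "C' = Max (insert 1 (C ` verts G))"
  have le: "C v \<le> C'" if "v \<in> verts G" for v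
    unfolding C'_def using finite_verts that by (auto intro: Max_ge)
  have "1 \<le> C'"
    unfolding C'_def using finite_verts by (auto intro: Max_ge)
  show thesis
  proof (rule that[of C'])
    fix w x y assume w: "w \<in> words G" "w \<noteq> []" "x \<in> X w" "y \<in> X w"
    have "dist (word_map f w x) (word_map f w y) \<le> C (tm G (last w)) * D w"
      using w word_verts[OF w(1,2)] by (intro C) (auto simp: X_def)
    also have "\<dots> \<le> C' * D w"
      using D_pos[OF w(1,2)] le[OF word_verts(2)[OF w(1,2)]] by (intro mult_right_mono) auto
    finally show "dist (word_map f w x) (word_map f w y) \<le> C' * D w" .
  qed (use \<open>1 \<le> C'\<close> in simp)
qed

text \<open>The image of \<open>X w\<close> contains a ball of radius
  \<open>D w / K * \<rho>\<close>, while contraction bounds its diameter by a multiple of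
  \<open>s ^ length w\<close>.\<close>

lemma D_decay:
  obtains C where "0 < C" "\<And>w. w \<in> words G \<Longrightarrow> w \<noteq> [] \<Longrightarrow> D w \<le> C * s ^ length w"
proof -
  obtain \<rho> where \<rho>: "0 < \<rho>" "\<And>v. v \<in> verts G \<Longrightarrow> ball (center v) \<rho> \<subseteq> interior (sp G v)"
    by (rule interior_radius) blast
  obtain M where M: "0 < M" "\<And>v x. v \<in> verts G \<Longrightarrow> x \<in> sp G v \<Longrightarrow> norm x < M"
    by (rule sp_bound) blast
  show thesis
  proof (rule that[of "2 * M * K / \<rho>"])
    fix w assume w: "w \<in> words G" "w \<noteq> []"
    note v = word_verts(2)[OF w]
    let ?c = "center (tm G (last w))"
    have sub: "ball ?c \<rho> \<subseteq> X w"
      using \<rho>(2)[OF v] interior_subset by (auto simp: X_def)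
    have "ball (word_map f w ?c) (D w / K * \<rho>) \<subseteq> word_map f w ` ball ?c \<rho>"
      using sub sp_S[OF v] \<rho>(1) by (intro ball_subset_word_image w) (auto simp: X_def)
    then have "ball (word_map f w ?c) (D w / K * \<rho>) \<subseteq> word_map f w ` X w"
      using sub by blast
    moreover have img: "dist a b \<le> s ^ length w * (2 * M)" if ab: "a \<in> word_map f w ` X w" "b \<in> word_map f w ` X w" for a b
    proof -
      obtain x y where xy: "x \<in> X w" "y \<in> X w" "a = word_map f w x" "b = word_map f w y"
        using ab by blast
      have "dist x y \<le> norm x + norm y"
        by (simp add: dist_norm norm_triangle_ineq4)
      also have "\<dots> \<le> 2 * M"
        using M(2)[OF v, of x] M(2)[OF v, of y] xy by (simp add: X_def)
      finally have "s ^ length w * dist x y \<le> s ^ length w * (2 * M)"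
        using s by (intro mult_left_mono) auto
      with word_contraction[OF w xy(1,2)] xy(3,4) show ?thesis by simp
    qed
    ultimately have "diameter (ball (word_map f w ?c) (D w / K * \<rho>)) \<le> s ^ length w * (2 * M)"
      using s M(1) by (intro diameter_le) (simp_all only: dist_norm[symmetric] subset_iff, simp)
    moreover have "0 < D w / K * \<rho>"
      using D_pos[OF w] K \<rho>(1) by simp
    ultimately have "2 * (D w / K * \<rho>) \<le> s ^ length w * (2 * M)"
      by (simp split: if_splits)
    moreover have "D w / K * \<rho> \<le> 2 * (D w / K * \<rho>)"
      using \<open>0 < D w / K * \<rho>\<close> by (simp only: mult_2 le_add_same_cancel1 less_imp_le)
    ultimately have "D w / K * \<rho> \<le> s ^ length w * (2 * M)"
      by (rule order.trans[rotated])
    then show "D w \<le> 2 * M * K / \<rho> * s ^ length w"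
      using K \<rho>(1) by (simp add: field_simps)
  qed (use M(1) K \<rho>(1) in simp)
qed

section \<open>Separation of the images of incomparable words\<close>

lemma word_continuous:
  assumes "w \<in> words G" "w \<noteq> []"
  shows "continuous_on (W (tm G (last w))) (word_map f w)"
  using word_derivative(1)[OF assms] has_derivative_continuous
  by (intro continuous_at_imp_continuous_on ballI) blast

lemma X_W:
  assumes "w \<in> words G" "w \<noteq> []"
  shows "X w \<subseteq> W (tm G (last w))" "interior (X w) \<subseteq> W (tm G (last w))" "interior (X w) \<subseteq> X w"
  using sp_S[OF word_verts(2)[OF assms]] nbhd(2)[OF word_verts(2)[OF assms]] interior_subset[of "X w"]
  by (auto simp: X_def)

lemma word_open:
  assumes "w \<in> words G" "w \<noteq> []"
  shows "open (word_map f w ` interior (X w))"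
  using word_continuous[OF assms] word_inj[OF assms] X_W(2)[OF assms]
  by (intro invariance_of_domain) (auto intro: continuous_on_subset inj_on_subset)

lemma word_interior:
  assumes "w \<in> words G" "w \<noteq> []"
  shows "word_map f w ` interior (X w) \<subseteq> interior (sp G (im G (hd w)))"
  using word_open[OF assms] word_sp(2)[OF assms] X_W(3)[OF assms] by (intro interior_maximal) auto

text \<open>Injectivity strips the common prefix; at the first differing letter the open set
  condition applies, because the remaining tails map interiors into interiors.\<close>

lemma incomparable_disjoint_interior:
  assumes "u \<in> words G" "v \<in> words G" "\<not> prefix u v" "\<not> prefix v u"
  shows "word_map f u ` interior (X u) \<inter> word_map f v ` interior (X v) = {}"
  using assms
proof (induction u arbitrary: v)
  case (Cons a u')
  then obtain b v' where v: "v = b # v'" by (cases v) auto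
  show ?case
  proof (cases "a = b")
    case True
    then have np: "\<not> prefix u' v'" "\<not> prefix v' u'" using Cons.prems v by auto
    then have ne: "u' \<noteq> []" "v' \<noteq> []" by auto
    have words: "u' \<in> words G" "v' \<in> words G" using Cons.prems v by (auto simp: words_Cons)
    note IH = Cons.IH[OF words np]
    have W: "word_map f u' ` interior (X u') \<subseteq> W (tm G a)" "word_map f v' ` interior (X v') \<subseteq> W (tm G a)"
      using word_into[OF words(1) ne(1)] X_W(2)[OF words(1) ne(1)] Cons_vert[OF Cons.prems(1) ne(1)]
        word_into[OF words(2) ne(2)] X_W(2)[OF words(2) ne(2)] Cons_vert[OF Cons.prems(2)[unfolded v] ne(2)] True
      by auto
    have inj: "inj_on (f a) (W (tm G a))" using Cons.prems(1) f_inj by (auto simp: words_Cons)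
    have "f a ` (word_map f u' ` interior (X u')) \<inter> f a ` (word_map f v' ` interior (X v')) = {}"
      using inj_on_image_Int[OF inj W] IH by simp
    then show ?thesis
      using True v ne by (simp add: image_image X_def)
  next
    case False
    have first: "word_map f w ` interior (X w) \<subseteq> phi G (hd w) ` interior (sp G (tm G (hd w)))"
      if w: "w \<in> words G" "w \<noteq> []" for w
    proof -
      obtain c r where cr: "w = c # r" using w(2) by (cases w) auto
      have "word_map f r x \<in> interior (sp G (tm G c))" if "x \<in> interior (X w)" for x
      proof (cases "r = []")
        case False
        then have "X r = X w" "r \<in> words G" "tm G c = im G (hd r)"
          using w cr Cons_vert[of c r] by (auto simp: X_def words_Cons)
        with word_interior[of r] that False show ?thesis by auto
      qed (use that cr in \<open>simp add: X_def\<close>)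
      moreover have "c \<in> edges G" using w cr by (simp add: words_Cons)
      ultimately show ?thesis
        using f_eq_phi[of c] interior_subset by (force simp: cr)
    qed
    show ?thesis
      using first[OF Cons.prems(1)] first[OF Cons.prems(2)] open_set_condition[OF _ _ False]
        Cons.prems(1,2) v by (auto simp: words_Cons disjoint_iff)
  qed
qed simp

text \<open>Coded points lie in images of the full spaces, so one side has to be enlarged. An open
  set that misses a set misses its closure, and each space is the closure of its interior.\<close>

lemma incomparable_disjoint:
  assumes "u \<in> words G" "v \<in> words G" "\<not> prefix u v" "\<not> prefix v u"
  shows "word_map f u ` interior (X u) \<inter> word_map f v ` X v = {}"
proof -
  have ne: "u \<noteq> []" "v \<noteq> []" using assms by auto
  have cl: "closure (interior (X v)) = X v"
    using regular word_verts(2)[OF assms(2) ne(2)] by (simp add: X_def)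
  have "word_map f v ` closure (interior (X v)) \<subseteq> closure (word_map f v ` interior (X v))"
    unfolding cl using word_continuous[OF assms(2) ne(2)] X_W(1)[OF assms(2) ne(2)]
    by (subst cl[symmetric], intro image_closure_subset closure_subset closed_closure)
      (simp add: cl continuous_on_subset)
  moreover have "word_map f u ` interior (X u) \<inter> closure (word_map f v ` interior (X v)) = {}"
    using incomparable_disjoint_interior[OF assms] word_open[OF assms(1) ne(1)]
    by (simp add: open_Int_closure_eq_empty)
  ultimately show ?thesis unfolding cl by blast
qed

section \<open>The coding map\<close>

lemma X_prefix: "X (map w [0..<Suc n]) = sp G (tm G (w n))"
  by (simp add: X_def)

lemma prefix_Suc_words:
  assumes "w \<in> infinite_words G"
  shows "map w [0..<Suc n] \<in> words G" "map w [0..<Suc n] \<noteq> []"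
  using prefix_in_words[OF assms, of "Suc n"] by simp_all

text \<open>The \<open>THE\<close> in \<open>coding\<close> needs existence and uniqueness: the
  images are nonempty, compact and nested, and contraction sends their diameters to 0. By
  \<open>word_sp\<close> the extensions \<open>f\<close> have the same images as the given
  maps.\<close>

lemma coding_Inter:
  assumes w: "w \<in> infinite_words G"
  shows "(\<Inter>n. word_map f (map w [0..<Suc n]) ` X (map w [0..<Suc n])) = {coding G w}"
proof -
  note p = prefix_Suc_words[OF w]
  define Q where "Q n = word_map f (map w [0..<Suc n]) ` X (map w [0..<Suc n])" for n
  obtain M where M: "0 < M" "\<And>v x. v \<in> verts G \<Longrightarrow> x \<in> sp G v \<Longrightarrow> norm x < M"
    by (rule sp_bound) blast
  have "\<exists>a. \<Inter> (range Q) = {a}"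
  proof (rule decreasing_closed_nest_sing)
    fix n
    have v: "tm G (last (map w [0..<Suc n])) \<in> verts G" by (rule word_verts(2)[OF p])
    then show "Q n \<noteq> {}" using sp_nonempty by (simp add: Q_def X_def)
    have "compact (Q n)"
      unfolding Q_def using sp_compact[OF v] X_W(1)[OF p, of n]
      by (intro compact_continuous_image continuous_on_subset[OF word_continuous[OF p]])
        (simp_all add: X_def)
    then show "closed (Q n)" by (rule compact_imp_closed)
  next
    have "Q (Suc n) \<subseteq> Q n" for n
    proof -
      have "inc G (w n) (w (Suc n))" "w n \<in> edges G" "w (Suc n) \<in> edges G"
        using w by (auto simp: infinite_words_def)
      then have "f (w (Suc n)) ` sp G (tm G (w (Suc n))) \<subseteq> sp G (tm G (w n))"
        using phi_sp[of "w (Suc n)"] f_eq_phi[of "w (Suc n)"] inc_vert[of "w n" "w (Suc n)"] by force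
      then show ?thesis
        unfolding Q_def X_prefix by (subst upt_Suc_append) (auto simp del: upt_Suc simp: image_iff)
    qed
    then show "Q n \<subseteq> Q m" if "m \<le> n" for m n
      using that by (rule lift_Suc_antimono_le)
  next
    fix e :: real assume "0 < e"
    then obtain n where n: "s ^ n < e / (2 * M)"
      using real_arch_pow_inv[of "e / (2 * M)" s] s M(1) by auto
    have "dist x y < e" if "x \<in> Q n" "y \<in> Q n" for x y
    proof -
      obtain a b where ab: "a \<in> X (map w [0..<Suc n])" "b \<in> X (map w [0..<Suc n])"
        "x = word_map f (map w [0..<Suc n]) a" "y = word_map f (map w [0..<Suc n]) b"
        using \<open>x \<in> Q n\<close> \<open>y \<in> Q n\<close> unfolding Q_def by blast
      have "dist a b \<le> norm a + norm b"
        by (simp add: dist_norm norm_triangle_ineq4)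
      also have "\<dots> \<le> 2 * M"
        using M(2)[OF word_verts(2)[OF p], of a n] M(2)[OF word_verts(2)[OF p], of b n] ab by (simp add: X_def)
      finally have "dist a b \<le> 2 * M" .
      have "dist x y \<le> s ^ Suc n * dist a b"
        using word_contraction[OF p ab(1,2)] ab(3,4) by simp
      also have "\<dots> \<le> s ^ n * (2 * M)"
        using s \<open>dist a b \<le> 2 * M\<close> by (intro mult_mono) (auto simp: mult_left_le_one_le)
      also have "\<dots> < e"
        using n M(1) by (simp add: field_simps)
      finally show ?thesis .
    qed
    then show "\<exists>n. \<forall>x\<in>Q n. \<forall>y\<in>Q n. dist x y < e" by blast
  qed
  then obtain a where a: "\<Inter> (range Q) = {a}" by blast
  have "Q n = word_map (phi G) (map w [0..<Suc n]) ` sp G (tm G (w n))" for n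
    unfolding Q_def using word_sp(1)[OF p] by (intro image_cong) (simp_all add: X_prefix del: upt_Suc)
  then have "coding G w = (THE x. \<Inter> (range Q) = {x})"
    by (simp add: coding_def del: upt_Suc)
  also have "\<dots> = a"
    using a by simp
  finally show ?thesis using a by (simp add: Q_def del: upt_Suc)
qed

lemma coding_mem:
  assumes "w \<in> infinite_words G"
  shows "coding G w \<in> word_map f (map w [0..<Suc n]) ` X (map w [0..<Suc n])"
  using coding_Inter[OF assms] by blast

lemma concat_word_infinite:
  assumes "0 < N" "\<And>n. length (w n) = N" "\<And>n. concat (map w [0..<n]) \<in> words G"
  shows "concat_word N w \<in> infinite_words G"
proof (rule infinite_wordsI)
  fix n
  have "n \<le> n * N" using \<open>0 < N\<close> by simp
  moreover have "map (concat_word N w) [0..<n * N] \<in> words G"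
    using assms(3)[of n] map_concat_word[of w N n] assms(2) by simp
  ultimately show "\<exists>m\<ge>n. map (concat_word N w) [0..<m] \<in> words G"
    by blast
qed

lemma range_concat_word:
  assumes "0 < N" "\<And>n. length (w n) = N"
  shows "range (concat_word N w) \<subseteq> (\<Union>n. set (w n))"
proof safe
  fix k
  have "w (k div N) ! (k mod N) \<in> set (w (k div N))"
    using assms by (intro nth_mem) simp
  then show "concat_word N w k \<in> (\<Union>n. set (w n))"
    by (auto simp: concat_word_def)
qed

section \<open>Porosity\<close>

text \<open>Compare \<open>w\<close> with the equally long prefix of a coded point in the image: the
  two are equal or incomparable, and \<open>incomparable_disjoint\<close> excludes the latter. If
  they are equal, injectivity moves the point back into \<open>B\<close>, where its next letter puts
  it in a first-level image.\<close>

lemma hole_image: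
  assumes "w \<in> words G" "w \<noteq> []" "B \<subseteq> interior (X w)"
    and B: "B \<inter> (\<Union>e\<in>edges G. phi G e ` sp G (tm G e)) = {}"
  shows "word_map f w ` B \<inter> limit_set G = {}"
proof (rule ccontr)
  assume "\<not> ?thesis"
  then obtain b \<tau> where b: "b \<in> B" and \<tau>: "\<tau> \<in> infinite_words G" and eq: "word_map f w b = coding G \<tau>"
    unfolding limit_set_def by auto
  define n where "n = length w"
  have "0 < n" using assms(2) by (simp add: n_def)
  then obtain m where m: "n = Suc m" by (cases n) auto
  have b_int: "b \<in> interior (X w)" using b assms(3) by blast
  define u where "u = map \<tau> [0..<n]"
  have u: "u \<in> words G" "u \<noteq> []" "length u = n"
    using prefix_Suc_words[OF \<tau>, of m] m by (simp_all add: u_def del: upt_Suc)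
  have "coding G \<tau> \<in> word_map f u ` X u"
    using coding_mem[OF \<tau>, of m] m by (simp add: u_def del: upt_Suc)
  then have "word_map f w ` interior (X w) \<inter> word_map f u ` X u \<noteq> {}"
    using b_int eq by (metis disjoint_iff imageI)
  then have "prefix w u \<or> prefix u w"
    using incomparable_disjoint[OF assms(1) u(1)] by blast
  then have "w = u"
    using u(3) by (auto simp: n_def prefix_def)
  have "coding G \<tau> \<in> word_map f (map \<tau> [0..<Suc n]) ` X (map \<tau> [0..<Suc n])"
    by (rule coding_mem[OF \<tau>])
  then obtain y where y: "y \<in> sp G (tm G (\<tau> n))" "coding G \<tau> = word_map f (u @ [\<tau> n]) y"
    by (auto simp: X_def u_def)
  have e: "\<tau> n \<in> edges G" "\<tau> m \<in> edges G" "inc G (\<tau> m) (\<tau> n)"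
    using \<tau> m by (auto simp: infinite_words_def)
  have last_u: "last u = \<tau> m" using m by (simp add: u_def)
  let ?z = "phi G (\<tau> n) y"
  have "word_map f w b = word_map f w ?z"
    using eq y f_eq_phi[OF e(1) y(1)] \<open>w = u\<close> by simp
  moreover have "?z \<in> X w"
    using phi_sp[OF e(1)] y(1) inc_vert[OF e(2,1,3)] last_u \<open>w = u\<close> by (auto simp: X_def)
  then have "?z \<in> W (tm G (last w))" using X_W(1)[OF assms(1,2)] by blast
  moreover have "b \<in> W (tm G (last w))" using b_int X_W(2)[OF assms(1,2)] by blast
  ultimately have "b = ?z"
    using word_inj[OF assms(1,2)] by (metis inj_onD)
  with b B y(1) e(1) show False by blast
qed

text \<open>Given a radius, take the first prefix whose image is small against it. As its last
  letter comes from the finite set \<open>F\<close>, the image is not much smaller than the radius;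
  a connecting word leads on to the vertex with the hole at bounded cost. Only the coding of the
  point is restricted to \<open>F\<close>: the hole misses the whole limit set.\<close>

lemma porous_on_finite_alphabet:
  assumes "finitely_irreducible G"
    and gap: "total_space G - closure (\<Union>e\<in>edges G. phi G e ` sp G (tm G e)) \<noteq> {}"
    and "finite F" "F \<subseteq> edges G"
  obtains c where "0 < c" "c < 1"
    "\<And>\<tau>. \<tau> \<in> infinite_words G \<Longrightarrow> range \<tau> \<subseteq> F \<Longrightarrow> c_porous_at c (limit_set G) (coding G \<tau>)"
proof -
  define Z where "Z = (\<Union>e\<in>edges G. phi G e ` sp G (tm G e))"
  obtain x0 v where v: "v \<in> verts G" and x0: "x0 \<in> sp G v" "x0 \<in> - closure Z"
    using gap by (auto simp: total_space_def Z_def)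
  \<comment> \<open>The gap point may lie on the boundary of its space; near it there are interior
    points outside \<open>closure Z\<close>.\<close>
  have "- closure Z \<inter> closure (interior (sp G v)) \<noteq> {}"
    using x0 regular[OF v] by auto
  then have "- closure Z \<inter> interior (sp G v) \<noteq> {}"
    using open_Int_closure_eq_empty[of "- closure Z" "interior (sp G v)"] by auto
  then obtain y where y: "y \<in> interior (sp G v) - closure Z" by blast
  have "open (interior (sp G v) - closure Z)" by (simp add: open_Diff)
  from openE[OF this y] obtain \<rho> where \<rho>: "0 < \<rho>" "ball y \<rho> \<subseteq> interior (sp G v) - closure Z" .
  \<comment> \<open>Words ending in \<open>e0\<close> have domain \<open>sp G v\<close>, the space
    that contains the hole.\<close>
  obtain e0 where e0: "e0 \<in> edges G" "tm G e0 = v"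
    by (rule ex_tm[OF v])
  obtain L where L: "finite L" "L \<subseteq> words G"
    "\<And>a b. a \<in> edges G \<Longrightarrow> b \<in> edges G \<Longrightarrow> \<exists>w\<in>L. a # w @ [b] \<in> words G"
    using assms(1) unfolding finitely_irreducible_def by auto
  obtain C where C: "0 < C" "\<And>w x y. w \<in> words G \<Longrightarrow> w \<noteq> [] \<Longrightarrow> x \<in> X w \<Longrightarrow> y \<in> X w \<Longrightarrow>
    dist (word_map f w x) (word_map f w y) \<le> C * D w"
    by (rule word_diameter) blast
  obtain C1 where C1: "0 < C1" "\<And>w. w \<in> words G \<Longrightarrow> w \<noteq> [] \<Longrightarrow> D w \<le> C1 * s ^ length w"
    by (rule D_decay) blast
  have F1: "finite ((\<lambda>e. [e]) ` F)" "(\<lambda>e. [e]) ` F \<subseteq> words G"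
    using assms(3,4) by (auto simp: words_Cons)
  obtain \<kappa>1 where \<kappa>1: "0 < \<kappa>1"
    "\<And>u v. v \<in> (\<lambda>e. [e]) ` F \<Longrightarrow> u @ v \<in> words G \<Longrightarrow> u \<noteq> [] \<Longrightarrow> \<kappa>1 * D u \<le> D (u @ v)"
    by (rule D_extension[OF F1]) blast
  define \<Lambda> where "\<Lambda> = {\<beta> @ [e0] | \<beta>. \<beta> \<in> L \<and> \<beta> @ [e0] \<in> words G}"
  have \<Lambda>: "finite \<Lambda>" "\<Lambda> \<subseteq> words G"
    unfolding \<Lambda>_def using L(1) by auto
  obtain \<kappa>2 where \<kappa>2: "0 < \<kappa>2"
    "\<And>u v. v \<in> \<Lambda> \<Longrightarrow> u @ v \<in> words G \<Longrightarrow> u \<noteq> [] \<Longrightarrow> \<kappa>2 * D u \<le> D (u @ v)"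
    by (rule D_extension[OF \<Lambda>]) blast
  \<comment> \<open>The image of the hole under the word \<open>u\<close> below contains a ball of
    radius \<open>D u / K * \<rho>\<close>, where \<open>D u\<close> is at least
    \<open>\<kappa>2 * \<kappa>1 * r / (2 * C)\<close>.\<close>
  define c where "c = min (1 / 2) (\<kappa>2 * \<kappa>1 * \<rho> / (2 * C * K))"
  have c: "0 < c" "c < 1" "c \<le> \<kappa>2 * \<kappa>1 * \<rho> / (2 * C * K)"
    using \<kappa>1(1) \<kappa>2(1) \<rho>(1) C(1) K by (auto simp: c_def)
  show thesis
  proof (rule that[OF c(1,2)])
    fix \<tau> assume \<tau>: "\<tau> \<in> infinite_words G" "range \<tau> \<subseteq> F"
    define p where "p n = map \<tau> [0..<Suc n]" for n
    have p: "p n \<in> words G" "p n \<noteq> []" "length (p n) = Suc n" for n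
      using prefix_Suc_words[OF \<tau>(1), of n] by (simp_all add: p_def del: upt_Suc)
    have p_Suc: "p (Suc n) = p n @ [\<tau> (Suc n)]" for n by (simp add: p_def)
    \<comment> \<open>The bound on \<open>r\<close> ensures that the first prefix is not yet small,
      so the prefix found below has a predecessor \<open>p k\<close> that is still large.\<close>
    have "c \<le> por (limit_set G) (coding G \<tau>) r" if r: "0 < r" "r < 2 * C * D (p 0)" for r
    proof -
      obtain m where m: "s ^ m < r / (2 * C * C1)"
        using real_arch_pow_inv[of "r / (2 * C * C1)" s] s C(1) C1(1) r(1) by auto
      have "C * D (p m) \<le> C * (C1 * s ^ Suc m)"
        using C1(2)[OF p(1,2), of m] C(1) p(3)[of m] by (intro mult_left_mono) auto
      also have "\<dots> \<le> C * (C1 * s ^ m)"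
        using s C(1) C1(1) by (intro mult_left_mono) (auto simp: mult_left_le_one_le)
      also have "\<dots> < r / 2"
        using m C(1) C1(1) by (simp add: field_simps)
      finally have "\<exists>n. C * D (p n) < r / 2" by blast
      then obtain n where n: "C * D (p n) < r / 2" "\<And>k. k < n \<Longrightarrow> \<not> C * D (p k) < r / 2"
        using exists_least_iff[of "\<lambda>n. C * D (p n) < r / 2"] by blast
      have "n \<noteq> 0"
      proof
        assume "n = 0"
        with n(1) have "C * D (p 0) < r / 2" by simp
        with r(2) show False by linarith
      qed
      then obtain k where k: "n = Suc k" by (cases n) auto
      have "r / (2 * C) \<le> D (p k)"
        using n(2)[of k] k C(1) by (simp add: field_simps)
      then have "\<kappa>1 * (r / (2 * C)) \<le> \<kappa>1 * D (p k)"
        using \<kappa>1(1) by (intro mult_left_mono) auto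
      also have "\<dots> \<le> D (p n)"
        using \<kappa>1(2)[of "[\<tau> n]" "p k"] \<tau>(2) p(1)[of n] p(2)[of k] by (auto simp: k p_Suc)
      finally have Dn: "\<kappa>1 * (r / (2 * C)) \<le> D (p n)" .
      have last_p: "last (p n) = \<tau> n" "\<tau> n \<in> edges G"
        using \<tau>(1) by (auto simp: p_def infinite_words_def)
      obtain \<beta> where \<beta>: "\<beta> \<in> L" "\<tau> n # \<beta> @ [e0] \<in> words G"
        using L(3)[OF last_p(2) e0(1)] by blast
      define u where "u = p n @ \<beta> @ [e0]"
      have tail: "\<beta> @ [e0] \<in> words G" "inc G (\<tau> n) (hd (\<beta> @ [e0]))"
        using \<beta>(2) by (auto simp: words_Cons)
      have u: "u \<in> words G" "u \<noteq> []"
        unfolding u_def words_append[of "p n"] using p(1)[of n] tail last_p(1) by auto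
      have X_u: "X u = sp G v" using e0 by (simp add: X_def u_def)
      have "\<kappa>2 * D (p n) \<le> D u"
        unfolding u_def using \<beta>(1) tail(1) u(1) p(2)[of n] by (intro \<kappa>2(2)) (auto simp: \<Lambda>_def u_def)
      then have Du: "\<kappa>2 * (\<kappa>1 * (r / (2 * C))) \<le> D u"
        using mult_left_mono[OF Dn, of \<kappa>2] \<kappa>2(1) by linarith
      have "c * r \<le> D u / K * \<rho>"
      proof -
        have "c * r \<le> \<kappa>2 * \<kappa>1 * \<rho> / (2 * C * K) * r"
          using c(3) r(1) by (intro mult_right_mono) auto
        also have "\<dots> = \<kappa>2 * (\<kappa>1 * (r / (2 * C))) * (\<rho> / K)" by simp
        also have "\<dots> \<le> D u * (\<rho> / K)"
          using Du \<rho>(1) K by (intro mult_right_mono) auto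
        finally show ?thesis by simp
      qed
      have y_sub: "ball y \<rho> \<subseteq> interior (X u)" using \<rho>(2) unfolding X_u by blast
      have "ball (word_map f u y) (c * r) \<subseteq> ball (word_map f u y) (D u / K * \<rho>)"
        using \<open>c * r \<le> D u / K * \<rho>\<close> by (rule subset_ball)
      also have "\<dots> \<subseteq> word_map f u ` ball y \<rho>"
        using y_sub X_W(3)[OF u] X_u sp_S[OF v] e0 \<rho>(1)
        by (intro ball_subset_word_image[OF u]) (auto simp: u_def)
      finally have sub: "ball (word_map f u y) (c * r) \<subseteq> word_map f u ` ball y \<rho>" .
      have "word_map f u ` ball y \<rho> \<inter> limit_set G = {}"
        using \<rho>(2) closure_subset[of Z] by (intro hole_image[OF u y_sub]) (auto simp: Z_def)
      \<comment> \<open>The image of the hole and the coded point both lie in the image of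
        \<open>p n\<close>, whose diameter is below \<open>r / 2\<close>.\<close>
      moreover have "word_map f u ` ball y \<rho> \<subseteq> ball (coding G \<tau>) r"
      proof
        fix z assume "z \<in> word_map f u ` ball y \<rho>"
        then obtain q where q: "q \<in> X u" "z = word_map f u q"
          using y_sub X_W(3)[OF u] by blast
        have "word_map f (\<beta> @ [e0]) q \<in> X (p n)"
          using word_sp(2)[OF tail(1), of q] q(1) append_vert[of "p n" "\<beta> @ [e0]"] u p(2)[of n]
          by (auto simp: X_def u_def)
        then have "z \<in> word_map f (p n) ` X (p n)"
          using q(2) by (auto simp: u_def)
        moreover have "coding G \<tau> \<in> word_map f (p n) ` X (p n)"
          unfolding p_def by (rule coding_mem[OF \<tau>(1)])
        ultimately have "dist (coding G \<tau>) z \<le> C * D (p n)"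
          using C(2)[OF p(1,2)] by (elim imageE) simp
        also have "\<dots> < r" using n(1) r(1) by linarith
        finally show "z \<in> ball (coding G \<tau>) r" by simp
      qed
      ultimately have "ball (word_map f u y) (c * r) \<subseteq> ball (coding G \<tau>) r - limit_set G"
        using sub by blast
      then show ?thesis using c(1) r(1) by (intro por_ge) auto
    qed
    moreover have "0 < 2 * C * D (p 0)"
      using C(1) D_pos[OF p(1,2), of 0] by simp
    ultimately show "c_porous_at c (limit_set G) (coding G \<tau>)"
      unfolding c_porous_at_def by (intro exI[of _ "2 * C * D (p 0)"]) auto
  qed
qed

section \<open>Fixed points and density\<close>

lemma concat_replicate_words:
  assumes "w \<in> words G" "w \<noteq> []" "w @ w \<in> words G"
  shows "concat (replicate n w) \<in> words G"
proof (induction n)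
  case (Suc n)
  then show ?case using assms by (cases n) (auto simp: words_append)
qed simp

lemma periodic_word:
  assumes "w \<in> words G" "w \<noteq> []" "w @ w \<in> words G"
  obtains \<tau> where "\<tau> \<in> infinite_words G" "range \<tau> \<subseteq> set w"
    "\<And>n. 0 < n \<Longrightarrow> map \<tau> [0..<n * length w] = concat (replicate n w)"
proof
  have eq: "map (\<lambda>_. w) [0..<n] = replicate n w" for n by (simp add: map_replicate_const)
  show "concat_word (length w) (\<lambda>_. w) \<in> infinite_words G"
    using assms concat_replicate_words[OF assms] by (intro concat_word_infinite) (auto simp: eq)
  show "range (concat_word (length w) (\<lambda>_. w)) \<subseteq> set w"
    using range_concat_word[of "length w" "\<lambda>_. w"] assms(2) by auto
  show "map (concat_word (length w) (\<lambda>_. w)) [0..<n * length w] = concat (replicate n w)" for n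
    using map_concat_word[of "\<lambda>_. w" "length w" n] by (simp add: eq)
qed

lemma last_concat_replicate: "0 < n \<Longrightarrow> last (concat (replicate n w)) = last w"
proof (induction n)
  case (Suc n)
  then show ?case by (cases n) (auto simp: last_append)
qed simp

text \<open>The powers of \<open>w\<close> are the prefixes of the periodic word at multiples of
  \<open>length w\<close>, so the coded point lies in the intersection that defines
  \<open>x\<close>.\<close>

lemma fixed_point_coding:
  assumes "x \<in> fixed_points G"
  obtains \<tau> where "\<tau> \<in> infinite_words G" "finite (range \<tau>)" "x = coding G \<tau>"
proof -
  obtain w where w: "w \<noteq> []" "w \<in> words G" "w @ w \<in> words G"
    and Int: "(\<Inter>n\<in>{1..}. word_map (phi G) (concat (replicate n w)) ` sp G (tm G (last w))) = {x}"
    using assms unfolding fixed_points_def by auto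
  obtain \<tau> where \<tau>: "\<tau> \<in> infinite_words G" "range \<tau> \<subseteq> set w"
    "\<And>n. 0 < n \<Longrightarrow> map \<tau> [0..<n * length w] = concat (replicate n w)"
    using periodic_word[OF w(2,1,3)] by metis
  have "coding G \<tau> \<in> word_map (phi G) (concat (replicate n w)) ` sp G (tm G (last w))" if "0 < n" for n
  proof -
    obtain m where m: "n * length w = Suc m" using \<open>0 < n\<close> w(1) by (cases "n * length w") auto
    let ?u = "concat (replicate n w)"
    have u: "map \<tau> [0..<Suc m] = ?u" using \<tau>(3)[OF that] m by simp
    have X_u: "X ?u = sp G (tm G (last w))" unfolding X_def last_concat_replicate[OF that] ..
    have "coding G \<tau> \<in> word_map f ?u ` X ?u" using coding_mem[OF \<tau>(1), of m] by (simp only: u)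
    also have "\<dots> = word_map (phi G) ?u ` X ?u"
      using word_sp(1)[OF prefix_Suc_words[OF \<tau>(1), of m]] by (intro image_cong) (simp_all only: u)
    finally show ?thesis by (simp only: X_u)
  qed
  then have "coding G \<tau> \<in> {x}" unfolding Int[symmetric] by auto
  then show thesis
    using that[OF \<tau>(1)] \<tau>(2) by (metis List.finite_set finite_subset singletonD)
qed

text \<open>A connecting word from the last letter back to the first closes any prefix to a cycle.
  The resulting periodic word shares that prefix, and images of long prefixes are small.\<close>

lemma limit_set_finite_alphabet_dense:
  assumes "finitely_irreducible G"
  shows "limit_set G \<subseteq> closure (coding G ` {\<tau> \<in> infinite_words G. finite (range \<tau>)})"
proof
  fix x assume "x \<in> limit_set G"
  then obtain \<tau> where \<tau>: "\<tau> \<in> infinite_words G" "x = coding G \<tau>" by (auto simp: limit_set_def)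
  obtain C where C: "0 < C" "\<And>w x y. w \<in> words G \<Longrightarrow> w \<noteq> [] \<Longrightarrow> x \<in> X w \<Longrightarrow> y \<in> X w \<Longrightarrow>
    dist (word_map f w x) (word_map f w y) \<le> C * D w"
    by (rule word_diameter) blast
  obtain C1 where C1: "0 < C1" "\<And>w. w \<in> words G \<Longrightarrow> w \<noteq> [] \<Longrightarrow> D w \<le> C1 * s ^ length w"
    by (rule D_decay) blast
  show "x \<in> closure (coding G ` {\<tau> \<in> infinite_words G. finite (range \<tau>)})"
    unfolding closure_approachable
  proof (intro allI impI)
    fix e :: real assume "0 < e"
    obtain n where n: "s ^ n < e / (C * C1)"
      using real_arch_pow_inv[of "e / (C * C1)" s] s C(1) C1(1) \<open>0 < e\<close> by auto
    define u where "u = map \<tau> [0..<Suc n]"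
    have u: "u \<in> words G" "u \<noteq> []" "length u = Suc n"
      using prefix_Suc_words[OF \<tau>(1), of n] by (simp_all add: u_def del: upt_Suc)
    obtain \<beta> where \<beta>: "last u # \<beta> @ [hd u] \<in> words G"
      using assms word_verts[OF u(1,2)] unfolding finitely_irreducible_def by blast
    define w where "w = u @ \<beta>"
    have w: "w \<in> words G" "w \<noteq> []" "w @ w \<in> words G"
      using u \<beta> by (auto simp: w_def words_append words_Cons hd_append split: if_splits)
    obtain \<sigma> where \<sigma>: "\<sigma> \<in> infinite_words G" "range \<sigma> \<subseteq> set w"
      "\<And>n. 0 < n \<Longrightarrow> map \<sigma> [0..<n * length w] = concat (replicate n w)"
      using periodic_word[OF w] by metis
    have "map \<sigma> [0..<Suc n] = take (Suc n) (map \<sigma> [0..<1 * length w])"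
      using u(3) by (simp add: take_map w_def del: upt_Suc)
    also have "\<dots> = u"
      using \<sigma>(3)[of 1] u(3) by (simp add: w_def)
    finally have \<sigma>u: "map \<sigma> [0..<Suc n] = u" .
    have "coding G \<sigma> \<in> word_map f u ` X u"
      using coding_mem[OF \<sigma>(1), of n] unfolding \<sigma>u .
    moreover have "x \<in> word_map f u ` X u"
      using coding_mem[OF \<tau>(1), of n] unfolding u_def \<tau>(2) .
    ultimately have "dist (coding G \<sigma>) x \<le> C * D u"
      using C(2)[OF u(1,2)] by (elim imageE) simp
    also have "\<dots> \<le> C * (C1 * s ^ n)"
    proof (rule mult_left_mono)
      have "D u \<le> C1 * s ^ Suc n" using C1(2)[OF u(1,2)] u(3) by simp
      also have "\<dots> \<le> C1 * s ^ n"
        using s C1(1) by (intro mult_left_mono) (auto simp: mult_left_le_one_le)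
      finally show "D u \<le> C1 * s ^ n" .
    qed (use C(1) in simp)
    also have "\<dots> < e"
      using n C(1) C1(1) by (simp add: field_simps)
    finally have "dist (coding G \<sigma>) x < e" .
    moreover have "finite (range \<sigma>)" using \<sigma>(2) by (rule finite_subset) simp
    ultimately show "\<exists>y\<in>coding G ` {\<tau> \<in> infinite_words G. finite (range \<tau>)}. dist y x < e"
      using \<sigma>(1) by blast
  qed
qed

section \<open>Dimension of finite subsystems\<close>

text \<open>Cover by the images of all words of length \<open>n\<close>. The factor
  \<open>D w powr (t - t')\<close> split off from \<open>D w powr t\<close> tends to 0 uniformly in
  \<open>w\<close>, which needs the strict \<open>t' < t\<close>.\<close>

lemma limit_set_null:
  assumes "0 \<le> t'" "t' < t" "0 \<le> M"
    and bound: "\<And>n A. 0 < n \<Longrightarrow> finite A \<Longrightarrow> A \<subseteq> {w \<in> words G. length w = n} \<Longrightarrow>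
      (\<Sum>w\<in>A. D w powr t') \<le> M"
  shows "hausdorff_measure t (limit_set G) = 0"
proof -
  obtain C where C: "0 < C" "\<And>w x y. w \<in> words G \<Longrightarrow> w \<noteq> [] \<Longrightarrow> x \<in> X w \<Longrightarrow> y \<in> X w \<Longrightarrow>
    dist (word_map f w x) (word_map f w y) \<le> C * D w"
    by (rule word_diameter) blast
  obtain C1 where C1: "0 < C1" "\<And>w. w \<in> words G \<Longrightarrow> w \<noteq> [] \<Longrightarrow> D w \<le> C1 * s ^ length w"
    by (rule D_decay) blast
  have "hausdorff_premeasure t \<delta> (limit_set G) \<le> ennreal \<epsilon>" if "0 < \<delta>" "0 < \<epsilon>" for \<delta> \<epsilon>
  proof -
    have lim0: "(\<lambda>n. C1 * s ^ n) \<longlonglongrightarrow> 0"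
      using s LIMSEQ_realpow_zero[of s] by (auto intro!: tendsto_mult_right_zero)
    have "(\<lambda>n. C * (C1 * s ^ n)) \<longlonglongrightarrow> 0"
      by (intro tendsto_mult_right_zero lim0)
    moreover have "(\<lambda>n. (C1 * s ^ n) powr (t - t')) \<longlonglongrightarrow> 0"
      using lim0 \<open>t' < t\<close> s C1(1) by (intro tendsto_zero_powrI[of _ _ _ "t - t'"]) auto
    then have "(\<lambda>n. C powr t * (C1 * s ^ n) powr (t - t') * M) \<longlonglongrightarrow> 0"
      by (intro tendsto_mult_left_zero tendsto_mult_right_zero)
    ultimately have "eventually (\<lambda>n. C * (C1 * s ^ n) < \<delta> \<and>
        C powr t * (C1 * s ^ n) powr (t - t') * M < \<epsilon> \<and> 0 < n) sequentially"
      using that by (intro eventually_conj order_tendstoD(2)[where y = 0 and a = \<delta>]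
          order_tendstoD(2)[where y = 0 and a = \<epsilon>] eventually_gt_at_top)
    then obtain n where n: "C * (C1 * s ^ n) < \<delta>"
        "C powr t * (C1 * s ^ n) powr (t - t') * M < \<epsilon>" "0 < n"
      by (auto simp: eventually_sequentially)
    define I where "I = {w \<in> words G. length w = n}"
    have I: "w \<in> words G" "w \<noteq> []" "D w \<le> C1 * s ^ n" if "w \<in> I" for w
      using that n(3) C1(2)[of w] by (auto simp: I_def)
    have dist: "dist x y \<le> C * D w" if "w \<in> I" "x \<in> word_map f w ` X w" "y \<in> word_map f w ` X w" for w x y
      using that C(2)[OF I(1,2)] by blast
    have diam: "diameter (word_map f w ` X w) \<le> C * D w" if "w \<in> I" for w
      using dist[OF that] C(1) D_pos[OF I(1,2)[OF that]] by (intro diameter_le) (auto simp: dist_norm)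
    have bdd: "bounded (word_map f w ` X w)" if "w \<in> I" for w
      using dist[OF that] unfolding bounded_two_points by blast
    have "hausdorff_premeasure t \<delta> (limit_set G) \<le> ennreal (C powr t * (C1 * s ^ n) powr (t - t') * M)"
    proof (rule hausdorff_premeasure_le_finite_sums[where I = I and U = "\<lambda>w. word_map f w ` X w"])
      have "countable (lists (edges G))" using countable_edges by simp
      then show "countable I"
        by (rule countable_subset[rotated]) (auto simp: I_def words_def)
      obtain m where m: "n = Suc m" using n(3) by (cases n) auto
      show "limit_set G \<subseteq> (\<Union>w\<in>I. word_map f w ` X w)"
      proof
        fix x assume "x \<in> limit_set G"
        then obtain \<tau> where \<tau>: "\<tau> \<in> infinite_words G" "x = coding G \<tau>" by (auto simp: limit_set_def)
        have "map \<tau> [0..<Suc m] \<in> I"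
          using prefix_Suc_words(1)[OF \<tau>(1), of m] m by (simp add: I_def del: upt_Suc)
        then show "x \<in> (\<Union>w\<in>I. word_map f w ` X w)"
          using coding_mem[OF \<tau>(1), of m] \<tau>(2) by blast
      qed
      show "diameter (word_map f w ` X w) \<le> \<delta>" if "w \<in> I" for w
      proof -
        have "C * D w \<le> C * (C1 * s ^ n)" using I(3)[OF that] C(1) by (intro mult_left_mono) auto
        with diam[OF that] n(1) show ?thesis by linarith
      qed
      fix B assume B: "finite B" "B \<subseteq> I"
      have "(\<Sum>w\<in>B. diam_pow t (word_map f w ` X w)) \<le>
          (\<Sum>w\<in>B. ennreal (C powr t * (C1 * s ^ n) powr (t - t') * D w powr t'))"
      proof (rule sum_mono)
        fix w assume "w \<in> B"
        then have w: "w \<in> I" using B by blast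
        have pos: "0 < D w" by (rule D_pos[OF I(1,2)[OF w]])
        have "diam_pow t (word_map f w ` X w) \<le> ennreal ((C * D w) powr t)"
          using diam[OF w] bdd[OF w] C(1) pos assms(1,2) by (intro diam_pow_le_ennreal) auto
        also have "(C * D w) powr t = C powr t * D w powr (t - t') * D w powr t'"
          using C(1) pos by (simp add: powr_mult flip: powr_add)
        also have "\<dots> \<le> C powr t * (C1 * s ^ n) powr (t - t') * D w powr t'"
          using I(3)[OF w] pos \<open>t' < t\<close> by (intro mult_right_mono mult_left_mono powr_mono2) auto
        finally show "diam_pow t (word_map f w ` X w) \<le>
            ennreal (C powr t * (C1 * s ^ n) powr (t - t') * D w powr t')"
          by (simp add: ennreal_leI)
      qed
      also have "\<dots> = ennreal (C powr t * (C1 * s ^ n) powr (t - t') * (\<Sum>w\<in>B. D w powr t'))"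
        by (subst sum_ennreal) (auto simp: sum_distrib_left)
      also have "\<dots> \<le> ennreal (C powr t * (C1 * s ^ n) powr (t - t') * M)"
        using bound[OF n(3) B(1)] B(2) by (intro ennreal_leI mult_left_mono) (auto simp: I_def)
      finally show "(\<Sum>w\<in>B. diam_pow t (word_map f w ` X w)) \<le>
          ennreal (C powr t * (C1 * s ^ n) powr (t - t') * M)" .
    qed (use bdd \<open>0 < \<delta>\<close> in auto)
    also have "\<dots> \<le> ennreal \<epsilon>"
      using n(2) by (intro ennreal_leI) simp
    finally show ?thesis .
  qed
  note small = this
  have "hausdorff_premeasure t \<delta> (limit_set G) \<le> 0" if "0 < \<delta>" for \<delta>
  proof (rule ennreal_le_epsilon)
    show "hausdorff_premeasure t \<delta> (limit_set G) \<le> 0 + ennreal e" if "0 < e" for e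
      using small[OF \<open>0 < \<delta>\<close> that] by simp
  qed
  then have "hausdorff_measure t (limit_set G) \<le> 0"
    unfolding hausdorff_measure_def by (intro SUP_least) simp
  then show ?thesis by simp
qed

text \<open>Only finiteness matters. For the exponent \<open>CARD('n)\<close> the sums are bounded
  by volume; the additional 1 gives the strict inequality in \<open>limit_set_null\<close>.\<close>

lemma hausdorff_dim_limit_set_le: "hausdorff_dim (limit_set G) \<le> ereal (real CARD('n) + 1)"
proof -
  obtain \<rho> where \<rho>: "0 < \<rho>" "\<And>v. v \<in> verts G \<Longrightarrow> ball (center v) \<rho> \<subseteq> interior (sp G v)"
    by (rule interior_radius) blast
  obtain R where R: "0 < R" "\<And>v x. v \<in> verts G \<Longrightarrow> x \<in> sp G v \<Longrightarrow> norm x < R"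
    by (rule sp_bound) blast
  \<comment> \<open>Comes from packing disjoint balls of radius \<open>D w / K * \<rho>\<close> into
    \<open>ball 0 R\<close>.\<close>
  define M where "M = (R * K / \<rho>) ^ CARD('n)"
  have "hausdorff_measure (real CARD('n) + 1) (limit_set G) = 0"
  proof (rule limit_set_null[where t' = "real CARD('n)" and M = M])
    fix n A assume "0 < n" and A: "finite A" "A \<subseteq> {w \<in> words G. length w = n}"
    have w: "w \<in> words G" "w \<noteq> []" "length w = n" if "w \<in> A" for w
      using that A(2) \<open>0 < n\<close> by auto
    define z where "z w = word_map f w (center (tm G (last w)))" for w
    have sub: "ball (z w) (D w / K * \<rho>) \<subseteq> word_map f w ` interior (X w)" if "w \<in> A" for w
    proof -
      note w = w[OF that] word_verts(2)[OF w(1,2)[OF that]]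
      have B: "ball (center (tm G (last w))) \<rho> \<subseteq> interior (X w)"
        using \<rho>(2)[OF w(4)] by (simp add: X_def)
      then have "ball (center (tm G (last w))) \<rho> \<subseteq> S (tm G (last w))"
        using X_W(3)[OF w(1,2)] sp_S[OF w(4)] by (auto simp: X_def)
      from ball_subset_word_image[OF w(1,2) this \<rho>(1)] B show ?thesis
        unfolding z_def by blast
    qed
    have "(\<Sum>w\<in>A. (D w / K * \<rho>) ^ DIM(real ^ 'n)) \<le> R ^ DIM(real ^ 'n)"
    proof (rule sum_disjoint_balls_le[OF A(1), where z = z and x = 0])
      show "disjoint_family_on (\<lambda>w. ball (z w) (D w / K * \<rho>)) A"
        unfolding disjoint_family_on_def
      proof (intro ballI impI)
        fix u v assume uv: "u \<in> A" "v \<in> A" "u \<noteq> v"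
        then have "\<not> prefix u v" "\<not> prefix v u"
          using w(3) by (metis append_eq_append_conv append_self_conv prefix_def)+
        from incomparable_disjoint_interior[OF w(1)[OF uv(1)] w(1)[OF uv(2)] this]
        show "ball (z u) (D u / K * \<rho>) \<inter> ball (z v) (D v / K * \<rho>) = {}"
          using sub[OF uv(1)] sub[OF uv(2)] by blast
      qed
      show "ball (z w) (D w / K * \<rho>) \<subseteq> ball 0 R" if wA: "w \<in> A" for w
      proof
        fix x assume "x \<in> ball (z w) (D w / K * \<rho>)"
        then obtain y where y: "y \<in> X w" "x = word_map f w y"
          using sub[OF wA] X_W(3)[OF w(1,2)[OF wA]] by blast
        then have "x \<in> sp G (im G (hd w))"
          using word_sp(2)[OF w(1,2)[OF wA]] by blast
        then show "x \<in> ball 0 R"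
          using R(2)[OF word_verts(4)[OF w(1,2)[OF wA]]] by simp
      qed
      show "0 \<le> D w / K * \<rho>" if "w \<in> A" for w
        using D_pos[OF w(1,2)[OF that]] K \<rho>(1) by simp
    qed (use R(1) in simp)
    then have "(\<rho> / K) ^ CARD('n) * (\<Sum>w\<in>A. D w ^ CARD('n)) \<le> R ^ CARD('n)"
      by (simp add: sum_distrib_left power_mult_distrib power_divide mult_ac)
    then have "(\<Sum>w\<in>A. D w ^ CARD('n)) \<le> M"
      using K \<rho>(1) by (simp add: M_def power_divide power_mult_distrib field_simps)
    then show "(\<Sum>w\<in>A. D w powr real CARD('n)) \<le> M"
      using D_pos[OF w(1,2)] by (simp add: powr_realpow)
  qed (use R(1) K \<rho>(1) in \<open>auto simp: M_def\<close>)
  then show ?thesis by (intro hausdorff_dim_le) auto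
qed

text \<open>The leading \<open>e0\<close> records that the concatenation may follow another block,
  which is what the induction consumes.\<close>

lemma concat_cyclic_words:
  assumes "\<And>i. i \<in> I \<Longrightarrow> e0 # i \<in> words G \<and> i \<noteq> [] \<and> last i = e0" "e0 \<in> edges G" "u \<in> lists I"
  shows "e0 # concat u \<in> words G \<and> last (e0 # concat u) = e0"
  using assms(3)
proof (induction u)
  case (Cons i u)
  then have i: "e0 # i \<in> words G" "i \<noteq> []" "last i = e0" using assms(1) by auto
  then have "(e0 # i) @ concat u \<in> words G"
    using Cons.IH unfolding words_append[of "e0 # i"] by (auto simp: words_Cons)
  moreover have "last (e0 # concat u) = e0" using Cons.IH by blast
  ultimately show ?case
    using i by (auto simp: last_append split: if_splits)
qed (simp add: words_Cons assms(2))

text \<open>Words of one fixed length that start and end compatibly with the letter \<open>e0\<close> can be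
  concatenated freely, so they form a finite iterated function system on one vertex.\<close>

lemma hausdorff_dim_cyclic_words_ge:
  assumes "finite I" and "0 < t" "0 < N"
    and I: "\<And>i. i \<in> I \<Longrightarrow> e0 # i \<in> words G \<and> length i = N \<and> last i = e0"
    and e0: "e0 \<in> edges G"
    and large: "1 \<le> (\<Sum>i\<in>I. (D i / K) powr t)"
    and F: "(\<Union>i\<in>I. set i) \<subseteq> F"
  shows "ereal t \<le> hausdorff_dim (coding G ` {\<tau> \<in> infinite_words G. range \<tau> \<subseteq> F})"
proof -
  obtain C where C: "0 < C" "\<And>w x y. w \<in> words G \<Longrightarrow> w \<noteq> [] \<Longrightarrow> x \<in> X w \<Longrightarrow> y \<in> X w \<Longrightarrow>
    dist (word_map f w x) (word_map f w y) \<le> C * D w"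
    by (rule word_diameter) blast
  obtain C1 where C1: "0 < C1" "\<And>w. w \<in> words G \<Longrightarrow> w \<noteq> [] \<Longrightarrow> D w \<le> C1 * s ^ length w"
    by (rule D_decay) blast
  obtain \<rho> where \<rho>: "0 < \<rho>" "\<And>v. v \<in> verts G \<Longrightarrow> ball (center v) \<rho> \<subseteq> interior (sp G v)"
    by (rule interior_radius) blast
  have I_ne: "i \<noteq> []" if "i \<in> I" for i using I[OF that] \<open>0 < N\<close> by auto
  have I_words: "i \<in> words G" if "i \<in> I" for i using I[OF that] by (simp add: words_Cons)
  have D_I: "0 < D i" if "i \<in> I" for i using D_pos I_words I_ne that by blast
  define Z where "Z = (\<Sum>i\<in>I. (D i / K) powr t)"
  \<comment> \<open>The division by \<open>K\<close> pays for the loss in \<open>D_append\<close> at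
    each new block, so products of weights stay below \<open>R u powr t\<close>. Normalising only
    lowers the weights, as \<open>1 \<le> Z\<close>.\<close>
  define p where "p i = (D i / K) powr t / Z" for i
  \<comment> \<open>\<open>D []\<close> is meaningless, so the root of the tree gets its value
    separately.\<close>
  define R where "R u = (if u = [] then 1 else D (concat u))" for u
  define Y where "Y u = word_map f (concat u) ` X (concat u)" for u
  define z where "z u = word_map f (concat u) (center (tm G (last (concat u))))" for u
  define \<kappa> where "\<kappa> = Min (insert 1 ((\<lambda>i. D i / K) ` I))"
  have "Z \<ge> 1" using large by (simp add: Z_def)
  have fin: "finite (insert 1 ((\<lambda>i. D i / K) ` I))" using \<open>finite I\<close> by simp
  have "0 < \<kappa>"
    unfolding \<kappa>_def using fin D_I K by (subst Min_gr_iff) auto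
  have \<kappa>: "\<kappa> \<le> D i / K" if "i \<in> I" for i
    unfolding \<kappa>_def using fin that by (intro Min_le) auto
  have p_le1: "p i \<le> (D i / K) powr t" for i
    using mult_left_mono[OF \<open>Z \<ge> 1\<close>, of "(D i / K) powr t"] \<open>Z \<ge> 1\<close>
    by (simp add: p_def divide_le_eq)
  have p_nonneg: "0 \<le> p i" for i
    using \<open>Z \<ge> 1\<close> by (simp add: p_def)
  have cw: "concat u \<in> words G" "concat u \<noteq> []" if "u \<in> lists I" "u \<noteq> []" for u
  proof -
    show "concat u \<in> words G"
      using concat_cyclic_words[OF _ e0 that(1)] I I_ne by (simp add: words_Cons)
    show "concat u \<noteq> []" using that I_ne by (cases u) auto
  qed
  have R_pos: "0 < R u" if "u \<in> lists I" for u
    using D_pos cw that by (auto simp: R_def)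
  have R_snoc: "R u * (D i / K) \<le> R (u @ [i])" if ui: "u \<in> lists I" "i \<in> I" for u i
  proof (cases "u = []")
    case True
    have "D i / K \<le> D i" using D_I[OF ui(2)] K by (simp add: divide_le_eq)
    then show ?thesis using True by (simp add: R_def)
  next
    case False
    have "concat (u @ [i]) \<in> words G" using cw[of "u @ [i]"] ui by simp
    then have "D (concat u) * D i / K \<le> D (concat u @ i)"
      using cw[OF ui(1) False] I_ne[OF ui(2)] by (intro D_append) auto
    then show ?thesis using False by (simp add: R_def)
  qed
  have len: "length (concat u) = length u * N" if "u \<in> lists I" for u
    using that I by (induction u) auto
  have balls: "ball (z u) (\<rho> / K * R u) \<subseteq> word_map f (concat u) ` interior (X (concat u))"
    if "u \<in> lists I" "u \<noteq> []" for u
  proof -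
    note w = cw[OF that]
    have B: "ball (center (tm G (last (concat u)))) \<rho> \<subseteq> interior (X (concat u))"
      using \<rho>(2)[OF word_verts(2)[OF w]] by (simp add: X_def)
    then have "ball (center (tm G (last (concat u)))) \<rho> \<subseteq> S (tm G (last (concat u)))"
      using X_W(3)[OF w] sp_S[OF word_verts(2)[OF w]] by (auto simp: X_def)
    from ball_subset_word_image[OF w this \<rho>(1)] B have
      "ball (z u) (D (concat u) / K * \<rho>) \<subseteq> word_map f (concat u) ` interior (X (concat u))"
      unfolding z_def by blast
    then show ?thesis using that(2) by (simp add: R_def mult.commute)
  qed
  have tree: "ereal t \<le> hausdorff_dim ((\<lambda>w. coding G (concat_word N w)) ` {w. \<forall>n. w n \<in> I})"
  proof (rule hausdorff_dim_ge_tree[where p = p and R = R and Y = Y and z = z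
        and \<kappa> = \<kappa> and c = "\<rho> / K" and C = C])
    show "sum p I = 1"
      using \<open>Z \<ge> 1\<close> by (simp add: p_def Z_def flip: sum_divide_distrib)
    show "R [] = 1" by (simp add: R_def)
    show "\<kappa> * R u \<le> R (u @ [i])" if "u \<in> lists I" "i \<in> I" for u i
    proof -
      have "\<kappa> * R u \<le> D i / K * R u"
        using \<kappa>[OF that(2)] R_pos[OF that(1)] by (intro mult_right_mono) auto
      with R_snoc[OF that] show ?thesis by (simp add: mult.commute)
    qed
    show "(\<lambda>n. R (map w [0..<n])) \<longlonglongrightarrow> 0" if w: "\<And>n. w n \<in> I" for w
    proof (rule tendsto_sandwich[where f = "\<lambda>_. 0" and h = "\<lambda>n. C1 * s ^ n"])
      have wl: "map w [0..<n] \<in> lists I" for n using w by auto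
      show "eventually (\<lambda>n. 0 \<le> R (map w [0..<n])) sequentially"
        using R_pos[OF wl] by (intro always_eventually allI) (simp add: less_imp_le)
      have "R (map w [0..<n]) \<le> C1 * s ^ n" if "0 < n" for n
      proof -
        have ne: "map w [0..<n] \<noteq> []" using that by simp
        have "R (map w [0..<n]) \<le> C1 * s ^ (n * N)"
          using C1(2)[OF cw[OF wl ne]] ne len[OF wl, of n] by (simp add: R_def)
        also have "\<dots> \<le> C1 * s ^ n"
          using s C1(1) \<open>0 < N\<close> by (intro mult_left_mono power_decreasing) auto
        finally show ?thesis .
      qed
      then show "eventually (\<lambda>n. R (map w [0..<n]) \<le> C1 * s ^ n) sequentially"
        using eventually_gt_at_top[of 0] by (rule eventually_mono[rotated])
      show "(\<lambda>n. C1 * s ^ n) \<longlonglongrightarrow> 0"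
        using s LIMSEQ_realpow_zero[of s] by (auto intro!: tendsto_mult_right_zero)
    qed simp
    show "prod_list (map p u) \<le> R u powr t" if "u \<in> lists I" for u
      using that
    proof (induction u rule: rev_induct)
      case (snoc i u)
      then have ui: "u \<in> lists I" "i \<in> I" by auto
      have "prod_list (map p (u @ [i])) = prod_list (map p u) * p i" by simp
      also have "\<dots> \<le> R u powr t * (D i / K) powr t"
        using snoc.IH[OF ui(1)] p_le1 p_nonneg by (intro mult_mono) auto
      also have "\<dots> = (R u * (D i / K)) powr t"
        using R_pos[OF ui(1)] D_I[OF ui(2)] K by (subst powr_mult) auto
      also have "\<dots> \<le> R (u @ [i]) powr t"
        using R_snoc[OF ui] R_pos[OF ui(1)] D_I[OF ui(2)] K \<open>0 < t\<close> by (intro powr_mono2) auto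
      finally show ?case .
    qed (simp add: R_def)
    show "dist a b \<le> C * R u" if "u \<in> lists I" "u \<noteq> []" "a \<in> Y u" "b \<in> Y u" for u a b
      using that(2-4) C(2)[OF cw[OF that(1,2)]] by (auto simp: Y_def R_def)
    show "ball (z u) (\<rho> / K * R u) \<subseteq> Y u" if "u \<in> lists I" "u \<noteq> []" for u
      using balls[OF that] X_W(3)[OF cw[OF that]] by (auto simp: Y_def)
    show "ball (z u) (\<rho> / K * R u) \<inter> ball (z v) (\<rho> / K * R v) = {}"
      if uv: "u \<in> lists I" "v \<in> lists I" "\<not> prefix u v" "\<not> prefix v u" for u v
    proof -
      have ne: "u \<noteq> []" "v \<noteq> []" using uv by auto
      have len_I: "length x = N" if "x \<in> set w" "w \<in> lists I" for x w
        using that I by auto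
      have "\<not> prefix (concat u) (concat v)" "\<not> prefix (concat v) (concat u)"
        using prefix_concatD[OF \<open>0 < N\<close>, of u v] prefix_concatD[OF \<open>0 < N\<close>, of v u] len_I uv by auto
      from incomparable_disjoint_interior[OF cw(1)[OF uv(1) ne(1)] cw(1)[OF uv(2) ne(2)] this]
      show ?thesis using balls[OF uv(1) ne(1)] balls[OF uv(2) ne(2)] by blast
    qed
    show "coding G (concat_word N w) \<in> Y (map w [0..<n])" if w: "\<And>n. w n \<in> I" and "0 < n" for w n
    proof -
      have wl: "map w [0..<n] \<in> lists I" for n using w by auto
      have lenw: "length (w n) = N" for n using I[OF w] by simp
      have "concat (map w [0..<n]) \<in> words G" for n
        using cw(1)[OF wl] by (cases "n = 0") auto
      then have inf: "concat_word N w \<in> infinite_words G"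
        using lenw \<open>0 < N\<close> by (intro concat_word_infinite)
      obtain m where m: "n * N = Suc m" using \<open>0 < n\<close> \<open>0 < N\<close> by (cases "n * N") auto
      have "map (concat_word N w) [0..<Suc m] = concat (map w [0..<n])"
        using map_concat_word[of w N n, OF lenw] m by simp
      with coding_mem[OF inf, of m] show ?thesis unfolding Y_def by (simp del: upt_Suc)
    qed
  qed (use assms(1,2) p_nonneg \<open>0 < \<kappa>\<close> \<rho>(1) K C(1) in auto)
  also have "\<dots> \<le> hausdorff_dim (coding G ` {\<tau> \<in> infinite_words G. range \<tau> \<subseteq> F})"
  proof (rule hausdorff_dim_mono, safe)
    fix w :: "nat \<Rightarrow> 'e list" assume w: "\<forall>n. w n \<in> I"
    then have wl: "map w [0..<n] \<in> lists I" for n by auto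
    have lenw: "length (w n) = N" for n using I w by simp
    have "concat (map w [0..<n]) \<in> words G" for n
      using cw(1)[OF wl] by (cases "n = 0") auto
    then have "concat_word N w \<in> infinite_words G"
      using lenw \<open>0 < N\<close> by (intro concat_word_infinite)
    moreover have "range (concat_word N w) \<subseteq> F"
      using range_concat_word[OF \<open>0 < N\<close>, of w] lenw w F by blast
    ultimately show "coding G (concat_word N w) \<in> coding G ` {\<tau> \<in> infinite_words G. range \<tau> \<subseteq> F}"
      by blast
  qed
  finally show ?thesis .
qed

text \<open>Closing a word to a cycle through \<open>e0\<close> takes a pair of connecting words.
  One fixed pair, found by pigeonhole, gives all cycles the same length and still carries a sum
  large enough to pay for every loss.\<close>

lemma finite_subsystem_dim:
  assumes "finitely_irreducible G" "0 < t" "ereal t < hausdorff_dim (limit_set G)"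
  obtains F where "finite F" "F \<subseteq> edges G"
    "ereal t \<le> hausdorff_dim (coding G ` {\<tau> \<in> infinite_words G. range \<tau> \<subseteq> F})"
proof -
  \<comment> \<open>\<open>limit_set_null\<close> needs room between the exponent of the sums and
    that of the measure.\<close>
  obtain t2 where t2: "t < t2" "ereal t2 < hausdorff_dim (limit_set G)"
    using ereal_dense2[OF assms(3)] by auto
  obtain e0 where e0: "e0 \<in> edges G"
    using gdms by (auto simp: is_gdms_def)
  obtain L where L: "finite L" "L \<subseteq> words G"
    "\<And>a b. a \<in> edges G \<Longrightarrow> b \<in> edges G \<Longrightarrow> \<exists>w\<in>L. a # w @ [b] \<in> words G"
    using assms(1) unfolding finitely_irreducible_def by auto
  define \<Lambda> where "\<Lambda> = {\<gamma> @ [e0] | \<gamma>. \<gamma> \<in> L \<and> \<gamma> @ [e0] \<in> words G}"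
  have \<Lambda>: "finite \<Lambda>" "\<Lambda> \<subseteq> words G"
    unfolding \<Lambda>_def using L(1) by auto
  obtain \<kappa>1 where \<kappa>1: "0 < \<kappa>1"
    "\<And>u v. v \<in> \<Lambda> \<Longrightarrow> u @ v \<in> words G \<Longrightarrow> u \<noteq> [] \<Longrightarrow> \<kappa>1 * D u \<le> D (u @ v)"
    by (rule D_extension[OF \<Lambda>]) blast
  obtain \<kappa>2 where \<kappa>2: "0 < \<kappa>2"
    "\<And>u v. v \<in> L \<Longrightarrow> v @ u \<in> words G \<Longrightarrow> u \<noteq> [] \<Longrightarrow> \<kappa>2 * D u \<le> D (v @ u)"
    by (rule D_extension[OF L(1,2)]) blast
  \<comment> \<open>\<open>B\<close> compensates for the factor \<open>\<kappa>2 * \<kappa>1\<close>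
    lost in closing a word and \<open>1 / K\<close> lost in concatenation; \<open>M\<close> allows
    one share \<open>B\<close> to each pair of connecting words.\<close>
  define B where "B = (K / (\<kappa>2 * \<kappa>1)) powr t"
  define M where "M = card (L \<times> L) * B"
  have "B > 0" using K \<kappa>1(1) \<kappa>2(1) by (simp add: B_def)
  have "\<exists>n A. 0 < n \<and> finite A \<and> A \<subseteq> {w \<in> words G. length w = n} \<and> M < (\<Sum>w\<in>A. D w powr t)"
  proof (rule ccontr)
    assume "\<not> ?thesis"
    then have *: "(\<Sum>w\<in>A. D w powr t) \<le> M"
      if "0 < n" "finite A" "A \<subseteq> {w \<in> words G. length w = n}" for n A
      using that by (meson not_less)
    have "0 \<le> M" using \<open>B > 0\<close> by (simp add: M_def)
    then have "hausdorff_measure t2 (limit_set G) = 0"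
      using assms(2) t2(1) * by (intro limit_set_null[where t' = t and M = M]) auto
    then have "hausdorff_dim (limit_set G) \<le> ereal t2"
      using assms(2) t2(1) by (intro hausdorff_dim_le) auto
    with t2(2) show False by simp
  qed
  then obtain n A where n: "0 < n" and A: "finite A" "A \<subseteq> {w \<in> words G. length w = n}"
    and sum_A: "M < (\<Sum>w\<in>A. D w powr t)"
    by blast
  have w: "w \<in> words G" "w \<noteq> []" "length w = n" if "w \<in> A" for w
    using that A(2) n by auto
  define E where "E \<beta> \<gamma> = {w \<in> A. e0 # \<beta> @ w @ \<gamma> @ [e0] \<in> words G}" for \<beta> \<gamma>
  have "\<exists>bc. bc \<in> L \<times> L \<and> w \<in> E (fst bc) (snd bc)" if "w \<in> A" for w
  proof -
    note w = w[OF that]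
    obtain \<beta> where \<beta>: "\<beta> \<in> L" "e0 # \<beta> @ [hd w] \<in> words G"
      using L(3)[OF e0 word_verts(3)[OF w(1,2)]] by blast
    obtain \<gamma> where \<gamma>: "\<gamma> \<in> L" "last w # \<gamma> @ [e0] \<in> words G"
      using L(3)[OF word_verts(1)[OF w(1,2)] e0] by blast
    have "w @ \<gamma> @ [e0] \<in> words G"
      using w(1) \<gamma>(2) by (auto simp: words_append[of w] words_Cons)
    moreover have "(e0 # \<beta>) @ [hd w] \<in> words G" using \<beta>(2) by simp
    ultimately have "(e0 # \<beta>) @ w @ \<gamma> @ [e0] \<in> words G"
      using w(2) unfolding words_append[of "e0 # \<beta>"] by simp
    then have "w \<in> E \<beta> \<gamma>" using that by (simp add: E_def)
    with \<beta>(1) \<gamma>(1) show ?thesis by (intro exI[of _ "(\<beta>, \<gamma>)"]) simp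
  qed
  then obtain g where g: "\<And>w. w \<in> A \<Longrightarrow> g w \<in> L \<times> L" "\<And>w. w \<in> A \<Longrightarrow> w \<in> E (fst (g w)) (snd (g w))"
    by metis
  \<comment> \<open>The sets \<open>E \<beta> \<gamma>\<close> may overlap, so the sum is split
    along the choice function \<open>g\<close>.\<close>
  have "\<exists>bc\<in>L \<times> L. B < (\<Sum>w\<in>E (fst bc) (snd bc). D w powr t)"
  proof (rule ccontr)
    assume not: "\<not> ?thesis"
    have fin: "finite (E \<beta> \<gamma>)" for \<beta> \<gamma> using A(1) by (simp add: E_def)
    have "(\<Sum>w\<in>A. D w powr t) = (\<Sum>bc\<in>L \<times> L. \<Sum>w | w \<in> A \<and> g w = bc. D w powr t)"
      using g(1) A(1) L(1) by (intro sum.group[symmetric] image_subsetI) simp_all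
    also have "\<dots> \<le> (\<Sum>bc\<in>L \<times> L. \<Sum>w\<in>E (fst bc) (snd bc). D w powr t)"
      using fin g(2) by (intro sum_mono sum_mono2) (auto, metis fst_conv snd_conv)
    also have "\<dots> \<le> (\<Sum>bc\<in>L \<times> L. B)"
      using not by (intro sum_mono) (auto simp: not_less)
    also have "\<dots> = M" by (simp add: M_def)
    finally show False using sum_A by simp
  qed
  then obtain \<beta> \<gamma> where \<beta>\<gamma>: "\<beta> \<in> L" "\<gamma> \<in> L" and sum_E: "B < (\<Sum>w\<in>E \<beta> \<gamma>. D w powr t)"
    by auto
  define h where "h w = \<beta> @ w @ \<gamma> @ [e0]" for w
  have inj: "inj_on h (E \<beta> \<gamma>)" by (simp add: inj_on_def h_def)
  have E: "w \<in> A" "e0 # h w \<in> words G" if "w \<in> E \<beta> \<gamma>" for w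
    using that by (auto simp: E_def h_def)
  have D_h: "\<kappa>2 * \<kappa>1 * D w \<le> D (h w)" if "w \<in> E \<beta> \<gamma>" for w
  proof -
    have hw: "\<beta> @ (w @ \<gamma> @ [e0]) \<in> words G" "w @ (\<gamma> @ [e0]) \<in> words G" "\<gamma> @ [e0] \<in> words G"
      using E(2)[OF that] by (auto simp: h_def words_Cons words_append)
    have "\<kappa>2 * (\<kappa>1 * D w) \<le> \<kappa>2 * D (w @ \<gamma> @ [e0])"
      using \<kappa>1(2)[OF _ hw(2)] w(2)[OF E(1)[OF that]] hw(3) \<beta>\<gamma>(2) \<kappa>2(1)
      by (intro mult_left_mono) (auto simp: \<Lambda>_def)
    also have "\<dots> \<le> D (h w)"
      using \<kappa>2(2)[OF \<beta>\<gamma>(1) hw(1)] by (simp add: h_def)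
    finally show ?thesis by (simp add: mult.assoc)
  qed
  define F where "F = (\<Union>i\<in>h ` E \<beta> \<gamma>. set i)"
  have fin_E: "finite (E \<beta> \<gamma>)" using A(1) by (simp add: E_def)
  show thesis
  proof (rule that)
    show "finite F" using fin_E by (simp add: F_def)
    show "F \<subseteq> edges G" using E(2) by (auto simp: F_def words_def)
    show "ereal t \<le> hausdorff_dim (coding G ` {\<tau> \<in> infinite_words G. range \<tau> \<subseteq> F})"
    proof (rule hausdorff_dim_cyclic_words_ge[OF _ \<open>0 < t\<close>])
      show "finite (h ` E \<beta> \<gamma>)" using fin_E by simp
      show "0 < length \<beta> + n + length \<gamma> + 1" by simp
      show "e0 # i \<in> words G \<and> length i = length \<beta> + n + length \<gamma> + 1 \<and> last i = e0"
        if "i \<in> h ` E \<beta> \<gamma>" for i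
        using that E w(3) by (auto simp: h_def)
      have "1 = ((\<kappa>2 * \<kappa>1) / K) powr t * B"
        using K \<kappa>1(1) \<kappa>2(1) by (simp add: B_def flip: powr_mult)
      also have "\<dots> \<le> ((\<kappa>2 * \<kappa>1) / K) powr t * (\<Sum>w\<in>E \<beta> \<gamma>. D w powr t)"
        using sum_E by (intro mult_left_mono) auto
      also have "\<dots> = (\<Sum>w\<in>E \<beta> \<gamma>. (\<kappa>2 * \<kappa>1 * D w / K) powr t)"
        unfolding sum_distrib_left
      proof (rule sum.cong)
        fix v assume "v \<in> E \<beta> \<gamma>"
        then have "0 < D v" using D_pos w E(1) by blast
        then show "((\<kappa>2 * \<kappa>1) / K) powr t * D v powr t = (\<kappa>2 * \<kappa>1 * D v / K) powr t"
          using K \<kappa>1(1) \<kappa>2(1) by (simp flip: powr_mult)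
      qed simp
      also have "\<dots> \<le> (\<Sum>w\<in>E \<beta> \<gamma>. (D (h w) / K) powr t)"
      proof (intro sum_mono powr_mono2 divide_right_mono)
        fix v assume v: "v \<in> E \<beta> \<gamma>"
        then have "0 < D v" using D_pos w E(1) by blast
        then show "0 \<le> \<kappa>2 * \<kappa>1 * D v / K" using K \<kappa>1(1) \<kappa>2(1) by simp
        show "\<kappa>2 * \<kappa>1 * D v \<le> D (h v)" by (rule D_h[OF v])
      qed (use \<open>0 < t\<close> K in auto)
      also have "\<dots> = (\<Sum>i\<in>h ` E \<beta> \<gamma>. (D i / K) powr t)"
        by (simp add: sum.reindex[OF inj])
      finally show "1 \<le> (\<Sum>i\<in>h ` E \<beta> \<gamma>. (D i / K) powr t)" .
    qed (use e0 in \<open>auto simp: F_def\<close>)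
  qed
qed

end

section \<open>From the definitions to the theorem\<close>

lemma conformal_gdms_system:
  assumes "conformal_gdms G"
  obtains W f S K s where "conformal_system G W f S K s"
proof -
  note c = assms[unfolded conformal_gdms_def]
  note gdms = conjunct1[OF c] and c = conjunct2[OF c]
  note reg = conjunct1[OF c] and c = conjunct2[OF c]
  note osc = conjunct1[OF c] and ex = conjunct2[OF c]
  obtain W f S where ext: "conformal_extension G W f"
    and nbhd: "\<forall>v\<in>verts G. compact (S v) \<and> sp G v \<subseteq> interior (S v) \<and> S v \<subseteq> W v"
    and "bounded_distortion G S f"
    using ex by (elim exE conjE) (rule that; assumption)
  obtain s where s: "0 < s" "s < 1" "\<forall>e\<in>edges G. s-lipschitz_on (sp G (tm G e)) (phi G e)"
    using gdms unfolding is_gdms_def by (elim exE conjE) (rule that; assumption)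
  obtain K where K: "1 \<le> K" and "\<exists>\<alpha>>0. \<forall>w\<in>words G. w \<noteq> [] \<longrightarrow>
       (\<forall>p\<in>S (tm G (last w)). \<forall>q\<in>S (tm G (last w)).
          \<bar>deriv_norm f w p / deriv_norm f w q - 1\<bar> \<le> K * norm (p - q) powr \<alpha> \<and>
          1 / K \<le> deriv_norm f w p / deriv_norm f w q \<and>
          deriv_norm f w p / deriv_norm f w q \<le> K)"
    using \<open>bounded_distortion G S f\<close> unfolding bounded_distortion_def by auto
  then have dist: "deriv_norm f w p / deriv_norm f w q \<le> K"
    if "w \<in> words G" "w \<noteq> []" "p \<in> S (tm G (last w))" "q \<in> S (tm G (last w))" for w p q
    using that by auto
  have "conformal_system G W f S K s"
  proof
    show "closure (interior (sp G v)) = sp G v" if "v \<in> verts G" for v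
      using bspec[OF reg that] by (auto dest: sym)
    show "connected (sp G v)" if "v \<in> verts G" for v
      using bspec[OF reg that] by simp
    show "s-lipschitz_on (sp G (tm G e)) (phi G e)" if "e \<in> edges G" for e
      using bspec[OF s(3) that] .
    show "phi G a ` interior (sp G (tm G a)) \<inter> phi G b ` interior (sp G (tm G b)) = {}"
      if "a \<in> edges G" "b \<in> edges G" "a \<noteq> b" for a b
      using bspec[OF bspec[OF osc that(1)] that(2)] that(3) by simp
    show "sp G v \<subseteq> interior (S v)" "S v \<subseteq> W v" if "v \<in> verts G" for v
      using bspec[OF nbhd that] by simp_all
  qed (fact gdms s(1) s(2) ext K dist)+
  with that show thesis .
qed

theorem theorem1p1:
  fixes G :: "('v, 'e, real ^ 'n) gdms"
  assumes "conformal_gdms G"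
    and "finitely_irreducible G"
    and "total_space G - closure (\<Union>e\<in>edges G. phi G e ` sp G (tm G e)) \<noteq> {}"
  shows
    "((\<forall>x\<in>fixed_points G. porous_at (limit_set G) x) \<and>
      (\<exists>D\<subseteq>limit_set G. limit_set G \<subseteq> closure D \<and> (\<forall>x\<in>D. porous_at (limit_set G) x))) \<and>
     (\<forall>\<epsilon>>0. \<exists>F\<subseteq>edges G. finite F \<and>
        hausdorff_dim (limit_set (subsystem G F)) > hausdorff_dim (limit_set G) - ereal \<epsilon> \<and>
        (\<exists>c\<in>{0<..<1}. \<forall>x\<in>limit_set (subsystem G F). c_porous_at c (limit_set G) x)) \<and>
     (\<exists>J\<subseteq>limit_set G. hausdorff_dim J = hausdorff_dim (limit_set G) \<and>
        (\<forall>x\<in>J. porous_at (limit_set G) x))"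
proof -
  obtain W f S K s where "conformal_system G W f S K s"
    using conformal_gdms_system[OF assms(1)] .
  then interpret conformal_system G W f S K s .
  \<comment> \<open>\<open>P\<close> serves both as the dense set in (i) and as the set of full
    dimension in (iii).\<close>
  define P where "P = coding G ` {\<tau> \<in> infinite_words G. finite (range \<tau>)}"
  have P_limit: "P \<subseteq> limit_set G" by (auto simp: P_def limit_set_def)
  have range_edges: "range \<tau> \<subseteq> edges G" if "\<tau> \<in> infinite_words G" for \<tau>
    using that by (auto simp: infinite_words_def)
  have porous: "porous_at (limit_set G) x" if xP: "x \<in> P" for x
  proof -
    obtain \<tau> where \<tau>: "\<tau> \<in> infinite_words G" "finite (range \<tau>)" "x = coding G \<tau>"
      using xP by (auto simp: P_def)
    obtain c where "0 < c" "c < 1" "c_porous_at c (limit_set G) (coding G \<tau>)"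
      by (rule porous_on_finite_alphabet[OF assms(2,3) \<tau>(2) range_edges[OF \<tau>(1)]]) (use \<tau>(1) in auto)
    then show ?thesis unfolding porous_at_def \<tau>(3) by auto
  qed
  have uniform: "\<exists>F\<subseteq>edges G. finite F \<and>
        hausdorff_dim (limit_set (subsystem G F)) > hausdorff_dim (limit_set G) - ereal \<epsilon> \<and>
        (\<exists>c\<in>{0<..<1}. \<forall>x\<in>limit_set (subsystem G F). c_porous_at c (limit_set G) x)"
    if "0 < \<epsilon>" for \<epsilon>
  proof -
    obtain d where d: "hausdorff_dim (limit_set G) = ereal d" "0 \<le> d"
      using hausdorff_dim_limit_set_le hausdorff_dim_nonneg[of "limit_set G"]
      by (cases "hausdorff_dim (limit_set G)") auto
    have "\<exists>F\<subseteq>edges G. finite F \<and> ereal (d - \<epsilon>) < hausdorff_dim (limit_set (subsystem G F))"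
    proof (cases "d = 0")
      case True
      \<comment> \<open>The empty alphabet suffices here: \<open>d - \<epsilon>\<close> is negative,
        and porosity on the empty limit set is vacuous.\<close>
      have "ereal (d - \<epsilon>) < hausdorff_dim (limit_set (subsystem G {}))"
        using True \<open>0 < \<epsilon>\<close> by (intro less_le_trans[OF _ hausdorff_dim_nonneg]) (simp add: zero_ereal_def)
      then show ?thesis by blast
    next
      case False
      \<comment> \<open>The term \<open>d / 2\<close> keeps \<open>t\<close> positive for large
        \<epsilon>, as \<open>finite_subsystem_dim\<close> requires.\<close>
      define t where "t = max (d - \<epsilon> / 2) (d / 2)"
      have t: "0 < t" "t < d" "d - \<epsilon> < t" using d(2) False \<open>0 < \<epsilon>\<close> by (auto simp: t_def)
      obtain F where F: "finite F" "F \<subseteq> edges G"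
        "ereal t \<le> hausdorff_dim (coding G ` {\<tau> \<in> infinite_words G. range \<tau> \<subseteq> F})"
        by (rule finite_subsystem_dim[OF assms(2) t(1)]) (use t(2) d(1) in auto)
      have "ereal (d - \<epsilon>) < ereal t" using t(3) by simp
      also have "\<dots> \<le> hausdorff_dim (limit_set (subsystem G F))"
        using F(3) by (simp add: limit_set_subsystem[OF F(2)])
      finally show ?thesis using F(1,2) by blast
    qed
    then obtain F where F: "F \<subseteq> edges G" "finite F"
      "ereal (d - \<epsilon>) < hausdorff_dim (limit_set (subsystem G F))" by blast
    obtain c where "0 < c" "c < 1"
      "\<And>\<tau>. \<tau> \<in> infinite_words G \<Longrightarrow> range \<tau> \<subseteq> F \<Longrightarrow> c_porous_at c (limit_set G) (coding G \<tau>)"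
      by (rule porous_on_finite_alphabet[OF assms(2,3) F(2,1)]) blast
    then have "\<exists>c\<in>{0<..<1}. \<forall>x\<in>limit_set (subsystem G F). c_porous_at c (limit_set G) x"
      by (intro bexI[of _ c]) (auto simp: limit_set_subsystem[OF F(1)])
    with F show ?thesis by (auto simp: d(1))
  qed
  have "hausdorff_dim (limit_set G) \<le> hausdorff_dim P"
  proof (rule ereal_le_epsilon2)
    fix \<epsilon> :: real assume "0 < \<epsilon>"
    then obtain F where F: "F \<subseteq> edges G" "finite F"
      "hausdorff_dim (limit_set (subsystem G F)) > hausdorff_dim (limit_set G) - ereal \<epsilon>"
      using uniform by blast
    have "limit_set (subsystem G F) \<subseteq> P"
      using F(2) by (auto simp: limit_set_subsystem[OF F(1)] P_def intro: finite_subset)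
    then have "hausdorff_dim (limit_set G) - ereal \<epsilon> \<le> hausdorff_dim P"
      using F(3) hausdorff_dim_mono by (metis less_imp_le order.trans)
    then show "hausdorff_dim (limit_set G) \<le> hausdorff_dim P + ereal \<epsilon>"
      by (simp add: ereal_minus_le)
  qed
  then have "hausdorff_dim P = hausdorff_dim (limit_set G)"
    using hausdorff_dim_mono[OF P_limit] by (rule antisym[rotated])
  moreover have "\<forall>x\<in>fixed_points G. porous_at (limit_set G) x"
  proof
    fix x assume "x \<in> fixed_points G"
    then obtain \<tau> where "\<tau> \<in> infinite_words G" "finite (range \<tau>)" "x = coding G \<tau>"
      by (rule fixed_point_coding)
    then show "porous_at (limit_set G) x" by (intro porous) (auto simp: P_def)
  qed
  moreover have "limit_set G \<subseteq> closure P"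
    unfolding P_def by (rule limit_set_finite_alphabet_dense[OF assms(2)])
  ultimately show ?thesis
    using P_limit porous uniform by blast
qed

end
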